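(* Let $\mathcal{F}\subseteq\mathcal{B}^{<\omega}(\mathbb{N})$ be any family of finite disjoint collections, let $\mathcal{D}_0$ be an infinite disjoint collection and let $\xi$ be a countable ordinal. Then there exists an infinite disjoint collection $\mathcal{D}<\mathcal{D}_0$ such that either $\mathcal{B}^\xi\cap\mathcal{B}^{<\omega}(\mathcal{D})\subseteq\mathcal{F}$, or $\mathcal{B}^\xi\cap\mathcal{B}^{<\omega}(\mathcal{D})\subseteq\mathcal{B}^{<\omega}(\mathbb{N})\setminus\mathcal{F}$.
   Context: $\mathbb{N}=\{1,2,\dots\}$. For nonempty $s,t\subseteq\mathbb{N}$ with $s$ finite, $s<t$ means $\max s<\min t$. A finite disjoint collection is a tuple $\mathbf{s}=(s_1,\dots,s_k)$, $k\ge 0$ (for $k=0$ it is the empty collection $\emptyset$), of nonempty finite subsets of $\mathbb{N}$ with $s_1<\dots<s_k$; an infinite disjoint collection is a sequence $\mathcal{D}=(s_n)_{n\in\mathbb{N}}$ of nonempty finite subsets of $\mathbb{N}$ with $s_n<s_{n+1}$ for all $n$. Collections are identified with the set of their members. $\mathcal{B}^{<\omega}(\mathbb{N})$ denotes the set of all finite disjoint collections. For a collection $\mathcal{D}$, $FU(\mathcal{D})$ is the set of all unions of finitely many (at least one) members of $\mathcal{D}$. For infinite disjoint collections, $\mathcal{D}_1<\mathcal{D}$ means $\mathcal{D}_1\subseteq FU(\mathcal{D})$. $\mathcal{B}^{<\omega}(\mathcal{D})$ is the set of finite disjoint collections all of whose members lie in $FU(\mathcal{D})$ (including $\emptyset$).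 Schreier families: fix, for every countable limit ordinal $\lambda>0$, a strictly increasing sequence $(\lambda_n)$ of successor ordinals $<\lambda$ with $\sup_n\lambda_n=\lambda$. Define $\mathcal{A}_\xi\subseteq[\mathbb{N}]^{<\omega}$ for $\xi<\omega_1$ recursively: (1) $\mathcal{A}_0=\{\emptyset\}$; (2) $\mathcal{A}_{\zeta+1}=\{\{n\}\cup s_1: n\in\mathbb{N},\ s_1\in\mathcal{A}_\zeta,\ \{n\}<s_1\}$ (with $\{n\}<\emptyset$ vacuously true); (3) $\mathcal{A}_{\omega^{\beta+1}}=\{s_1\cup\dots\cup s_n: s_1<\dots<s_n\in\mathcal{A}_{\omega^\beta},\ n=\min s_1\}$; (4) for a countable limit ordinal $\lambda>0$, $\mathcal{A}_{\omega^\lambda}=\{s\in[\mathbb{N}]^{<\omega}: s\in\mathcal{A}_{\omega^{\lambda_n}}\text{ where }n=\min s\}$; (5) for a limit ordinal $\xi$ with $\omega^a<\xi<\omega^{a+1}$ ($0<a<\omega_1$), written $\xi=p\omega^a+\sum_{i=1}^m p_i\omega^{a_i}$ with $m\ge0$, $p,p_i\ge1$ integers, $a>a_1>\dots>a_m>0$ (and $p>1$ or $m\ge1$): $\mathcal{A}_\xi=\{s_0\cup s_1\cup\dots\cup s_m: s_m<\dots<s_1<s_0,\ s_0=s^0_1\cup\dots\cup s^0_p\text{ with }s^0_1<\dots<s^0_p\in\mathcal{A}_{\omega^a},\ s_i=s^i_1\cup\dots\cup s^i_{p_i}\text{ with }s^i_1<\dots<s^i_{p_i}\in\mathcal{A}_{\omega^{a_i}}\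 (1\le i\le m)\}$. Block Schreier families: $\mathcal{B}^0=\{\emptyset\}$, and for $1\le\xi<\omega_1$, $\mathcal{B}^\xi=\{(s_1,\dots,s_k): k\ge1,\ s_1<\dots<s_k$ nonempty finite subsets of $\mathbb{N}$, $\{\min s_1,\dots,\min s_k\}\in\mathcal{A}_\xi\}$. *)

theory Defs
  imports "HOL-Library.Countable_Set_Type"
begin

section \<open>Countable ordinals\<close>

text \<open>
  The countable ordinals are the elements of the first uncountable ordinal.  The latter is
  represented by \<^term>\<open>cardSuc natLeq\<close>, a well-order of minimal order type among those of
  cardinality \<open>\<aleph>\<^sub>1\<close>.
\<close>

typedef cord = "Field (cardSuc natLeq)"
  using Field_cardSuc_not_empty[OF natLeq_Card_order] by blast

instantiation cord :: wellorder
begin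

definition less_eq_cord :: "cord \<Rightarrow> cord \<Rightarrow> bool" where
  "x \<le> y \<longleftrightarrow> (Rep_cord x, Rep_cord y) \<in> cardSuc natLeq"

definition less_cord :: "cord \<Rightarrow> cord \<Rightarrow> bool" where
  "(x :: cord) < y \<longleftrightarrow> x \<le> y \<and> \<not> y \<le> x"

instance
proof -
  have W: "Well_order (cardSuc natLeq)"
    by (rule cardSuc_Well_order[OF natLeq_Card_order])
  then have refl: "refl_on (Field (cardSuc natLeq)) (cardSuc natLeq)"
    and tr: "trans (cardSuc natLeq)" and an: "antisym (cardSuc natLeq)"
    and tot: "total_on (Field (cardSuc natLeq)) (cardSuc natLeq)"
    and wf: "wf (cardSuc natLeq - Id)"
    by (auto simp: well_order_on_def linear_order_on_def partial_order_on_def preorder_on_def)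
  show "OFCLASS(cord, wellorder_class)"
  proof
    fix x y z :: cord
    show "(x < y) = (x \<le> y \<and> \<not> y \<le> x)" by (rule less_cord_def)
    show "x \<le> x" using refl Rep_cord by (auto simp: less_eq_cord_def refl_on_def)
    show "x \<le> y \<Longrightarrow> y \<le> z \<Longrightarrow> x \<le> z"
      unfolding less_eq_cord_def by (rule transD[OF tr])
    show "x \<le> y \<Longrightarrow> y \<le> x \<Longrightarrow> x = y"
      using antisymD[OF an, of "Rep_cord x" "Rep_cord y"] by (simp add: less_eq_cord_def Rep_cord_inject)
  next
    fix x y :: cord
    show "x \<le> y \<or> y \<le> x"
      using tot refl Rep_cord[of x] Rep_cord[of y]
      by (cases "x = y") (auto simp: less_eq_cord_def total_on_def refl_on_def Rep_cord_inject)
  next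
    fix P :: "cord \<Rightarrow> bool" and a
    assume step: "\<And>x. (\<And>y. y < x \<Longrightarrow> P y) \<Longrightarrow> P x"
    have "wf (inv_image (cardSuc natLeq - Id) Rep_cord)" using wf by (rule wf_inv_image)
    moreover have "{(x, y). x < y} \<subseteq> inv_image (cardSuc natLeq - Id) Rep_cord"
      by (auto simp: less_cord_def less_eq_cord_def)
    ultimately have "wf {(x :: cord, y). x < y}" by (rule wf_subset)
    then show "P a" by (induction a rule: wf_induct_rule) (auto intro: step)
  qed
qed

end

context includes cardinal_syntax
begin

lemma countable_initial_segment: "countable {y. y < (x :: cord)}"
proof -
  have co: "Card_order (cardSuc natLeq)" by (rule cardSuc_Card_order[OF natLeq_Card_order])
  have "|underS (cardSuc natLeq) (Rep_cord x)| <o cardSuc natLeq"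
    using card_of_underS[OF co Rep_cord] .
  then have "|underS (cardSuc natLeq) (Rep_cord x)| \<le>o natLeq"
    using cardSuc_ordLeq_ordLess[OF natLeq_Card_order card_of_Card_order] by blast
  then have "countable (underS (cardSuc natLeq) (Rep_cord x))"
    by (simp add: countable_card_le_natLeq)
  moreover have "Rep_cord ` {y. y < x} \<subseteq> underS (cardSuc natLeq) (Rep_cord x)"
    by (auto simp: underS_def less_cord_def less_eq_cord_def Rep_cord_inject)
  ultimately have "countable (Rep_cord ` {y. y < x})" by (rule countable_subset[rotated])
  then show ?thesis
    by (rule countable_image_inj_on) (auto simp: inj_on_def Rep_cord_inject)
qed

lemma countable_strictly_bounded:
  assumes "countable (A :: cord set)"
  shows "\<exists>b. \<forall>a\<in>A. a < b"
proof (rule ccontr)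
  assume "\<nexists>b. \<forall>a\<in>A. a < b"
  then have "(UNIV :: cord set) = A \<union> (\<Union>a\<in>A. {y. y < a})" by (force simp: not_less le_less)
  with assms have "countable (UNIV :: cord set)"
    using countable_initial_segment by (metis countable_UN countable_Un)
  then have "countable (Field (cardSuc natLeq))"
    by (metis countable_image type_definition.Rep_range type_definition_cord)
  then have "|Field (cardSuc natLeq)| \<le>o natLeq" by (simp add: countable_card_le_natLeq)
  moreover have "natLeq <o |Field (cardSuc natLeq)|"
    by (meson cardSuc_Card_order cardSuc_greater card_of_Field_ordIso natLeq_Card_order
        ordIso_symmetric ordLess_ordIso_trans)
  ultimately show False using not_ordLess_ordLeq by blast
qed

end

text \<open>
  Sums, products and powers of \<open>\<omega>\<close> are given as suprema: \<open>a + b\<close> is the supremum of \<open>a\<close> and all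
  \<open>(a + c) + 1\<close> with \<open>c < b\<close>, \<open>a \<cdot> b\<close> is the supremum of all \<open>a \<cdot> c + a\<close> with \<open>c < b\<close>, and
  \<open>\<omega>\<^sup>b\<close> is the supremum of \<open>1\<close> and all \<open>\<omega>\<^sup>c \<cdot> \<omega>\<close> with \<open>c < b\<close>.  The usual recursion equations are
  derived below.
\<close>

definition ozero :: cord where "ozero = (LEAST x. True)"

definition osuc :: "cord \<Rightarrow> cord" where "osuc a = (LEAST b. a < b)"

definition is_succ :: "cord \<Rightarrow> bool" where "is_succ a \<longleftrightarrow> (\<exists>b. a = osuc b)"

definition is_limit :: "cord \<Rightarrow> bool" where "is_limit a \<longleftrightarrow> ozero < a \<and> \<not> is_succ a"

definition omega :: cord where "omega = (LEAST a. is_limit a)"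

definition ofin :: "nat \<Rightarrow> cord" where "ofin n = (osuc ^^ n) ozero"

function oadd :: "cord \<Rightarrow> cord \<Rightarrow> cord" where
  "oadd a b = (LEAST x. a \<le> x \<and> (\<forall>c\<in>{..<b}. osuc (oadd a c) \<le> x))"
  by pat_completeness auto
termination by (relation "inv_image {(x, y). x < y} snd") (rule wf_inv_image[OF wf], simp)
declare oadd.simps [simp del]

function omul :: "cord \<Rightarrow> cord \<Rightarrow> cord" where
  "omul a b = (LEAST x. \<forall>c\<in>{..<b}. oadd (omul a c) a \<le> x)"
  by pat_completeness auto
termination by (relation "inv_image {(x, y). x < y} snd") (rule wf_inv_image[OF wf], simp)
declare omul.simps [simp del]

function opow_omega :: "cord \<Rightarrow> cord" where
  "opow_omega b = (LEAST x. ofin 1 \<le> x \<and> (\<forall>c\<in>{..<b}. omul (opow_omega c) omega \<le> x))"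
  by pat_completeness auto
termination by (relation "{(x, y). x < y}") (rule wf, simp)
declare opow_omega.simps [simp del]

lemma ozero_le [simp]: "ozero \<le> a"
  unfolding ozero_def by (rule Least_le) simp

lemma less_osuc [simp]: "a < osuc a"
  unfolding osuc_def using countable_strictly_bounded[of "{a}"] by (auto intro: LeastI_ex)

lemma osuc_le_iff [simp]: "osuc a \<le> b \<longleftrightarrow> a < b"
  using Least_le[of "\<lambda>b. a < b" b] less_le_trans[OF less_osuc] by (auto simp: osuc_def)

lemma less_osuc_iff: "a < osuc b \<longleftrightarrow> a \<le> b"
  using osuc_le_iff[of b a] by (meson not_le)

lemma osuc_less_iff [simp]: "osuc a < osuc b \<longleftrightarrow> a < b"
  by (simp only: less_osuc_iff osuc_le_iff)

lemma osuc_inject [simp]: "osuc a = osuc b \<longleftrightarrow> a = b"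
  by (metis neq_iff osuc_less_iff)

lemma is_limit_osuc_less: "is_limit l \<Longrightarrow> a < l \<Longrightarrow> osuc a < l"
  unfolding is_limit_def is_succ_def le_less[of "osuc a"] 
  using osuc_le_iff[of a l] by (auto simp: le_less)

lemma cord_cases [case_names zero succ limit]:
  obtains "a = ozero" | b where "a = osuc b" | "is_limit a"
  using ozero_le[of a] by (auto simp: is_limit_def is_succ_def le_less)


lemma cord_Least_le_iff:
  assumes "countable A"
  shows "(LEAST x :: cord. \<forall>a\<in>A. a \<le> x) \<le> y \<longleftrightarrow> (\<forall>a\<in>A. a \<le> y)"
proof -
  have "\<exists>x. \<forall>a\<in>A. a \<le> x"
    using countable_strictly_bounded[OF assms] by (meson less_imp_le)
  then have ub: "\<forall>a\<in>A. a \<le> (LEAST x. \<forall>a\<in>A. a \<le> x)" by (rule LeastI_ex)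
  show ?thesis
  proof
    show "(LEAST x. \<forall>a\<in>A. a \<le> x) \<le> y \<Longrightarrow> \<forall>a\<in>A. a \<le> y"
      using ub by (blast intro: order_trans)
    show "\<forall>a\<in>A. a \<le> y \<Longrightarrow> (LEAST x. \<forall>a\<in>A. a \<le> x) \<le> y"
      by (rule Least_le)
  qed
qed

lemma oadd_le_iff: "oadd a b \<le> x \<longleftrightarrow> a \<le> x \<and> (\<forall>c<b. oadd a c < x)"
proof -
  have "countable (insert a ((\<lambda>c. osuc (oadd a c)) ` {c. c < b}))"
    using countable_initial_segment by (intro countable_insert countable_image)
  from cord_Least_le_iff[OF this, of x] show ?thesis
    by (subst oadd.simps) (auto simp: lessThan_def)
qed

lemma omul_le_iff: "omul a b \<le> x \<longleftrightarrow> (\<forall>c<b. oadd (omul a c) a \<le> x)"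
proof -
  have "countable ((\<lambda>c. oadd (omul a c) a) ` {c. c < b})"
    using countable_initial_segment by (intro countable_image)
  from cord_Least_le_iff[OF this, of x] show ?thesis
    by (subst omul.simps) (auto simp: lessThan_def)
qed

lemma opow_omega_le_iff:
  "opow_omega b \<le> x \<longleftrightarrow> ofin 1 \<le> x \<and> (\<forall>c<b. omul (opow_omega c) omega \<le> x)"
proof -
  have "countable (insert (ofin 1) ((\<lambda>c. omul (opow_omega c) omega) ` {c. c < b}))"
    using countable_initial_segment by (intro countable_insert countable_image)
  from cord_Least_le_iff[OF this, of x] show ?thesis
    by (subst opow_omega.simps) (auto simp: lessThan_def)
qed

lemma cord_eqI: "(\<And>x :: cord. a \<le> x \<longleftrightarrow> b \<le> x) \<Longrightarrow> a = b"
  by (meson order_antisym order_refl)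

lemma not_less_ozero [simp]: "\<not> a < ozero"
  by (simp add: not_less)

lemma oadd_ozero [simp]: "oadd a ozero = a"
  by (rule cord_eqI) (simp add: oadd_le_iff)

lemma oadd_ge: "a \<le> oadd a b"
  using oadd_le_iff[of a b "oadd a b"] by simp

lemma oadd_less: "c < b \<Longrightarrow> oadd a c < oadd a b"
  using oadd_le_iff[of a b "oadd a b"] by simp

lemma oadd_osuc [simp]: "oadd a (osuc b) = osuc (oadd a b)"
proof (rule cord_eqI)
  fix x
  have "oadd a c < x" if "c \<le> b" "oadd a b < x" for c
    using that oadd_less[of c b a] by (auto simp: le_less)
  moreover have "a \<le> x" if "oadd a b < x"
    using that oadd_ge[of a b] by (meson order_trans less_imp_le)
  ultimately show "oadd a (osuc b) \<le> x \<longleftrightarrow> osuc (oadd a b) \<le> x"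
    unfolding oadd_le_iff[of a "osuc b"] less_osuc_iff osuc_le_iff by blast
qed

lemma oadd_limit: "is_limit b \<Longrightarrow> oadd a b \<le> x \<longleftrightarrow> (\<forall>c<b. oadd a c \<le> x)"
proof (intro iffI allI impI)
  assume b: "is_limit b" and x: "\<forall>c<b. oadd a c \<le> x"
  show "oadd a b \<le> x"
    unfolding oadd_le_iff[of a b]
  proof (intro conjI allI impI)
    show "a \<le> x" using x b oadd_ge[of a ozero] by (auto simp: is_limit_def)
    fix c assume "c < b"
    then show "oadd a c < x" using x is_limit_osuc_less[OF b, of c] oadd_osuc[of a c] by (metis osuc_le_iff)
  qed
next
  fix c assume "oadd a b \<le> x" "c < b"
  then show "oadd a c \<le> x" using oadd_less[of c b a] by (meson less_imp_le order_trans)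
qed

lemma omul_ozero [simp]: "omul a ozero = ozero"
  by (rule cord_eqI) (simp add: omul_le_iff)

lemma omul_step_le: "c < b \<Longrightarrow> oadd (omul a c) a \<le> omul a b"
  using omul_le_iff[of a b "omul a b"] by simp

lemma omul_osuc [simp]: "omul a (osuc b) = oadd (omul a b) a"
proof (rule cord_eqI)
  fix x
  show "omul a (osuc b) \<le> x \<longleftrightarrow> oadd (omul a b) a \<le> x"
  proof
    assume "oadd (omul a b) a \<le> x"
    moreover have "oadd (omul a c) a \<le> oadd (omul a b) a" if "c \<le> b" for c
      using that omul_step_le[of c b a] oadd_ge[of "omul a b" a] order_trans by (auto simp: le_less)
    ultimately show "omul a (osuc b) \<le> x"
      unfolding omul_le_iff[of a "osuc b"] less_osuc_iff by (meson order_trans)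
  qed (simp add: omul_le_iff[of a "osuc b"])
qed

lemma omul_limit: "is_limit b \<Longrightarrow> omul a b \<le> x \<longleftrightarrow> (\<forall>c<b. omul a c \<le> x)"
proof (intro iffI allI impI)
  fix c assume "omul a b \<le> x" "c < b"
  then show "omul a c \<le> x"
    using omul_step_le[of c b a] oadd_ge[of "omul a c" a] by (meson order_trans)
next
  assume b: "is_limit b" and x: "\<forall>c<b. omul a c \<le> x"
  then have "oadd (omul a c) a \<le> x" if "c < b" for c
    using is_limit_osuc_less[OF b that] by (metis omul_osuc)
  then show "omul a b \<le> x" by (simp add: omul_le_iff[of a b])
qed

lemma opow_omega_ozero [simp]: "opow_omega ozero = ofin 1"
  by (rule cord_eqI) (simp add: opow_omega_le_iff)

lemma ofin_simps [simp]: "ofin 0 = ozero" "ofin (Suc n) = osuc (ofin n)"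
  by (simp_all add: ofin_def)

lemma is_limit_omega: "is_limit omega"
proof -
  obtain b where b: "\<forall>a\<in>range ofin. a < b"
    using countable_strictly_bounded[of "range ofin"] by auto
  define l where "l = (LEAST b. \<forall>a\<in>range ofin. a < b)"
  have l: "ofin n < l" for n
    using LeastI[of "\<lambda>b. \<forall>a\<in>range ofin. a < b", OF b] by (simp add: l_def)
  have "l \<noteq> osuc c" for c
  proof
    assume c: "l = osuc c"
    have "ofin n < c" for n using l[of "Suc n"] by (simp add: c)
    then have "l \<le> c" unfolding l_def by (intro Least_le) auto
    then show False using c less_osuc[of c] by simp
  qed
  then have "is_limit l" using l[of 0] by (auto simp: is_limit_def is_succ_def)
  then show ?thesis unfolding omega_def by (rule LeastI)
qed

lemma less_omega_iff: "a < omega \<longleftrightarrow> (\<exists>n. a = ofin n)"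
proof
  show "\<exists>n. a = ofin n \<Longrightarrow> a < omega"
  proof clarify
    fix n show "ofin n < omega"
      by (induction n)
        (use is_limit_omega in \<open>auto simp: is_limit_def[of omega] intro: is_limit_osuc_less\<close>)
  qed
  show "a < omega \<Longrightarrow> \<exists>n. a = ofin n"
  proof (induction a rule: less_induct)
    case (less a)
    show ?case
    proof (cases a rule: cord_cases)
      case zero
      then show ?thesis by (metis ofin_simps(1))
    next
      case (succ b)
      then show ?thesis using less by (metis less_osuc less_trans ofin_simps(2))
    next
      case limit
      then have "omega \<le> a" unfolding omega_def by (rule Least_le)
      then show ?thesis using less.prems by simp
    qed
  qed
qed

lemma opow_omega_pos: "ozero < opow_omega b"
proof -
  have "ofin 1 \<le> opow_omega b" using opow_omega_le_iff[of b "opow_omega b"] by simp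
  then show ?thesis by simp
qed

lemma omul_omega_ge: "a \<le> omul a omega"
proof -
  have "ofin 1 < omega" using less_omega_iff by blast
  then have "omul a (ofin 1) \<le> omul a omega"
    using omul_limit[OF is_limit_omega, of a "omul a omega"] by blast
  moreover have "a \<le> oadd ozero a"
  proof (induction a rule: less_induct)
    case (less a)
    then have "c < oadd ozero a" if "c < a" for c
      using oadd_less[OF that, of ozero] that by (meson order_le_less_trans)
    then show ?case by (meson less_irrefl not_le)
  qed
  ultimately show ?thesis by simp
qed

lemma opow_omega_osuc [simp]: "opow_omega (osuc b) = omul (opow_omega b) omega"
proof (rule cord_eqI)
  fix x
  have le: "omul (opow_omega c) omega \<le> opow_omega b" if "c < b" for c
    using opow_omega_le_iff[of b "opow_omega b"] that by simp
  have "ofin 1 \<le> opow_omega b" using opow_omega_le_iff[of b "opow_omega b"] by simp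
  then have one: "ofin 1 \<le> omul (opow_omega b) omega"
    using omul_omega_ge by (rule order_trans)
  have "omul (opow_omega c) omega \<le> omul (opow_omega b) omega" if "c \<le> b" for c
  proof (cases "c = b")
    case False
    then have "omul (opow_omega c) omega \<le> opow_omega b" using le[of c] that by simp
    then show ?thesis using omul_omega_ge by (rule order_trans)
  qed simp
  with one show "opow_omega (osuc b) \<le> x \<longleftrightarrow> omul (opow_omega b) omega \<le> x"
    unfolding opow_omega_le_iff[of "osuc b"] less_osuc_iff
    by (blast intro: order_trans)
qed

lemma opow_omega_limit: "is_limit b \<Longrightarrow> opow_omega b \<le> x \<longleftrightarrow> (\<forall>c<b. opow_omega c \<le> x)"
proof (intro iffI allI impI)
  fix c assume "opow_omega b \<le> x" "c < b"
  then show "opow_omega c \<le> x"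
    using opow_omega_le_iff[of b x] omul_omega_ge[of "opow_omega c"] order_trans by blast
next
  assume b: "is_limit b" and x: "\<forall>c<b. opow_omega c \<le> x"
  then have "opow_omega ozero \<le> x" by (simp only: is_limit_def)
  moreover have "omul (opow_omega c) omega \<le> x" if "c < b" for c
    using x is_limit_osuc_less[OF b that] by (metis opow_omega_osuc)
  ultimately show "opow_omega b \<le> x"
    unfolding opow_omega_le_iff[of b] by simp
qed

section \<open>Finite and infinite disjoint collections\<close>

text \<open>
  The index set \<open>{1, 2, \<dots>}\<close> of the mathematics is the set \<open>{1..}\<close> of positive elements of type
  \<^typ>\<open>nat\<close>.  The relation \<open>blt\<close> is meant for finite sets and holds vacuously if one of them
  is empty.
\<close>

definition blt :: "nat set \<Rightarrow> nat set \<Rightarrow> bool" where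
  "blt s t \<longleftrightarrow> s = {} \<or> t = {} \<or> Max s < Min t"

definition block :: "nat set \<Rightarrow> bool" where
  "block s \<longleftrightarrow> finite s \<and> s \<noteq> {} \<and> s \<subseteq> {1..}"

definition finite_collections :: "nat set list set" where
  "finite_collections = {ss. (\<forall>s\<in>set ss. block s) \<and> sorted_wrt blt ss}"

definition infinite_collection :: "(nat \<Rightarrow> nat set) \<Rightarrow> bool" where
  "infinite_collection D \<longleftrightarrow> (\<forall>n. block (D n)) \<and> (\<forall>n. blt (D n) (D (Suc n)))"

definition FU :: "nat set set \<Rightarrow> nat set set" where
  "FU C = {\<Union> E | E. E \<subseteq> C \<and> finite E \<and> E \<noteq> {}}"

definition refines :: "(nat \<Rightarrow> nat set) \<Rightarrow> (nat \<Rightarrow> nat set) \<Rightarrow> bool" where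
  "refines D\<^sub>1 D \<longleftrightarrow> range D\<^sub>1 \<subseteq> FU (range D)"

definition finite_collections_in :: "(nat \<Rightarrow> nat set) \<Rightarrow> nat set list set" where
  "finite_collections_in D = {ss \<in> finite_collections. set ss \<subseteq> FU (range D)}"

section \<open>Schreier families\<close>

text \<open>
  \<open>L l n\<close> (for \<open>n \<ge> 1\<close>) is the \<open>n\<close>-th term of the sequence of successor ordinals that is fixed
  for the limit ordinal \<open>l\<close>.  Values at \<open>n = 0\<close> and at non-limits are irrelevant.
\<close>

definition fundamental_sequences :: "(cord \<Rightarrow> nat \<Rightarrow> cord) \<Rightarrow> bool" where
  "fundamental_sequences L \<longleftrightarrow>
    (\<forall>l. is_limit l \<longrightarrow>
      strict_mono_on {1..} (L l) \<and>
      (\<forall>n\<ge>1. is_succ (L l n) \<and> L l n < l) \<and>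
      (\<forall>u. (\<forall>n\<ge>1. L l n \<le> u) \<longrightarrow> l \<le> u))"

lemma fundamental_sequences_exist: "\<exists>L. fundamental_sequences L"
proof -
  have "\<exists>g :: nat \<Rightarrow> cord. strict_mono g \<and> (\<forall>n. is_succ (g n) \<and> g n < l) \<and>
    (\<forall>u. (\<forall>n\<ge>1. g n \<le> u) \<longrightarrow> l \<le> u)" if l: "is_limit l" for l
  proof -
    have "{b. b < l} \<noteq> {}" using l by (auto simp: is_limit_def)
    then obtain f :: "nat \<Rightarrow> cord" where f: "range f = {b. b < l}"
      using countable_initial_segment[of l] by (metis uncountable_def)
    define g where "g = rec_nat (osuc ozero) (\<lambda>n x. osuc (max x (f n)))"
    have g: "g 0 = osuc ozero" "g (Suc n) = osuc (max (g n) (f n))" for n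
      by (simp_all add: g_def)
    have "g n < g (Suc n)" for n by (simp add: g less_osuc_iff)
    then have "strict_mono g" by (simp add: strict_mono_Suc_iff)
    moreover have "is_succ (g n)" for n by (cases n) (auto simp: g is_succ_def)
    moreover have "g n < l" for n
    proof (induction n)
      case 0
      then show ?case using l by (auto simp: g is_limit_def intro: is_limit_osuc_less[OF l])
    next
      case (Suc n)
      moreover have "f n < l" using f by (metis mem_Collect_eq rangeI)
      ultimately have "max (g n) (f n) < l" by simp
      then show ?case unfolding g by (rule is_limit_osuc_less[OF l])
    qed
    moreover have "l \<le> u" if u: "\<forall>n\<ge>1. g n \<le> u" for u
    proof (rule ccontr)
      assume "\<not> l \<le> u"
      then obtain n where "f n = u" using f by (metis mem_Collect_eq not_le rangeE)
      then have "u < g (Suc n)" by (simp add: g less_osuc_iff)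
      moreover have "g (Suc n) \<le> u" using u by simp
      ultimately show False by simp
    qed
    ultimately show ?thesis by (intro exI[of _ g] conjI allI impI) auto
  qed
  then obtain L :: "cord \<Rightarrow> nat \<Rightarrow> cord" where
    "\<And>l. is_limit l \<Longrightarrow> strict_mono (L l) \<and> (\<forall>n. is_succ (L l n) \<and> L l n < l) \<and>
    (\<forall>u. (\<forall>n\<ge>1. L l n \<le> u) \<longrightarrow> l \<le> u)"
    by metis
  then show ?thesis
    unfolding fundamental_sequences_def
    by (intro exI[of _ L]) (auto simp: strict_mono_on_def strict_mono_def)
qed

text \<open>
  \<open>schreier L \<xi> s\<close> says \<open>s \<in> \<A>\<^sub>\<xi>\<close>.  Each ordinal falls under exactly one of the five rules, and
  the rules refer only to families of smaller index, so the inductive definition is the recursive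
  one.  In rule \<open>sum\<close> the leading term is the one with index \<open>0\<close>, and \<open>T i\<close> is the list
  \<open>s\<^sup>i\<^sub>1 < \<dots> < s\<^sup>i\<^sub>p\<close> (with \<open>p = p\<^sub>i\<close>) whose union is \<open>s\<^sub>i\<close>.
\<close>

inductive schreier :: "(cord \<Rightarrow> nat \<Rightarrow> cord) \<Rightarrow> cord \<Rightarrow> nat set \<Rightarrow> bool"
  for L :: "cord \<Rightarrow> nat \<Rightarrow> cord" where
  zero: "schreier L ozero {}"
| succ: "schreier L (osuc \<zeta>) ({n} \<union> s)"
    if "1 \<le> n" "schreier L \<zeta> s" "blt {n} s"
| pow_succ: "schreier L (opow_omega (osuc \<beta>)) (\<Union> (set ss))"
    if "ss \<noteq> []" "length ss = Min (hd ss)" "sorted_wrt blt ss"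
      "\<forall>t\<in>set ss. schreier L (opow_omega \<beta>) t"
| pow_limit: "schreier L (opow_omega l) s"
    if "is_limit l" "finite s" "s \<noteq> {}" "s \<subseteq> {1..}" "schreier L (opow_omega (L l (Min s))) s"
| sum: "schreier L \<xi> (\<Union>i\<le>m. \<Union> (set (T i)))"
    if "is_limit \<xi>" "ozero < a 0" "opow_omega (a 0) < \<xi>" "\<xi> < opow_omega (osuc (a 0))"
      "\<forall>i\<le>m. 1 \<le> p i" "\<forall>i<m. a (Suc i) < a i" "ozero < a m" "1 < p 0 \<or> 1 \<le> m"
      "\<xi> = foldr (\<lambda>i x. oadd (omul (opow_omega (a i)) (ofin (p i))) x) [0..<Suc m] ozero"
      "\<forall>i\<le>m. length (T i) = p i \<and> sorted_wrt blt (T i) \<and>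
        (\<forall>t\<in>set (T i). schreier L (opow_omega (a i)) t)"
      "\<forall>i<m. blt (\<Union> (set (T (Suc i)))) (\<Union> (set (T i)))"

definition schreier_family :: "(cord \<Rightarrow> nat \<Rightarrow> cord) \<Rightarrow> cord \<Rightarrow> nat set set" where
  "schreier_family L \<xi> = {s. schreier L \<xi> s}"

definition block_schreier :: "(cord \<Rightarrow> nat \<Rightarrow> cord) \<Rightarrow> cord \<Rightarrow> nat set list set" where
  "block_schreier L \<xi> =
    (if \<xi> = ozero then {[]}
     else {ss \<in> finite_collections. ss \<noteq> [] \<and> Min ` set ss \<in> schreier_family L \<xi>})"

end

theory Submission
  imports Defs "HOL-Library.Sublist"
begin

text \<open>
  The families \<open>\<A>\<^sub>\<xi>\<close>, and hence the families \<open>\<B>\<^sup>\<xi>\<close>, are thin: no member is a proper initial segment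
  of another one.  For thin families the dichotomy is a Nash-Williams theorem.  Fix an idempotent
  ultrafilter \<open>U\<close> on blocks that contains all tails of \<open>FU D\<^sub>0\<close>, and let a finite collection be
  accepted if it extends a member of \<open>\<F> \<inter> \<B>\<^sup>\<xi>\<close> or if \<open>U\<close>-almost all of its one-block extensions are
  accepted.  Acceptance and rejection both pass to \<open>U\<close>-almost all one-block extensions, so Galvin's
  construction gives some \<open>D\<close> all of whose finite collections behave like the empty one.  An accepted
  collection is comparable with a member of \<open>\<F> \<inter> \<B>\<^sup>\<xi>\<close>, so by thinness an accepted member of \<open>\<B>\<^sup>\<xi>\<close>
  lies in \<open>\<F>\<close>.
\<close>

lemma blt_iff: "finite s \<Longrightarrow> finite t \<Longrightarrow> blt s t \<longleftrightarrow> (\<forall>x\<in>s. \<forall>y\<in>t. x < y)"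
  by (cases "s = {} \<or> t = {}") (auto simp: blt_def)

section \<open>Idempotent ultrafilters\<close>

definition ultrafilter :: "'a filter \<Rightarrow> bool" where
  "ultrafilter F \<longleftrightarrow> F \<noteq> bot \<and> (\<forall>P. eventually P F \<or> eventually (\<lambda>x. \<not> P x) F)"

text \<open>Zorn's lemma for the reversed order, with the infimum of a chain as its bound. It serves
  for properness alone and for properness together with idempotence.\<close>

lemma minimal_filter_exists:
  fixes F :: "'a filter"
  assumes "Q F"
    and Inf: "\<And>C. C \<noteq> {} \<Longrightarrow> (\<And>G H. G \<in> C \<Longrightarrow> H \<in> C \<Longrightarrow> G \<le> H \<or> H \<le> G) \<Longrightarrow>
      (\<And>G. G \<in> C \<Longrightarrow> Q G) \<Longrightarrow> Q (Inf C)"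
  obtains G where "G \<le> F" "Q G" "\<And>H. H \<le> G \<Longrightarrow> Q H \<Longrightarrow> H = G"
proof -
  define A where "A = {G. G \<le> F \<and> Q G}"
  have "\<exists>m\<in>A. \<forall>a\<in>A. m \<ge> a \<longrightarrow> a = m"
  proof (rule predicate_Zorn)
    show "partial_order_on A (relation_of (\<ge>) A)"
      by (rule partial_order_on_relation_ofI) auto
    fix C assume C: "C \<in> Chains (relation_of (\<ge>) A)"
    then have sub: "C \<subseteq> A" and ch: "G \<le> H \<or> H \<le> G" if "G \<in> C" "H \<in> C" for G H
      using that by (auto simp: Chains_def relation_of_def)
    show "\<exists>u\<in>A. \<forall>a\<in>C. a \<ge> u"
    proof (cases "C = {}")
      case True
      then show ?thesis using assms(1) by (auto simp: A_def)
    next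
      case False
      have CA: "C \<subseteq> A" using C by (auto simp: Chains_def relation_of_def)
      have "Q (Inf C)" using False ch CA by (intro Inf) (auto simp: A_def)
      moreover have "Inf C \<le> F" using False CA by (auto simp: A_def intro: Inf_lower2)
      ultimately show ?thesis by (auto simp: A_def intro: Inf_lower)
    qed
  qed
  then obtain G where "G \<in> A" "\<forall>H\<in>A. H \<le> G \<longrightarrow> H = G" by blast
  then show thesis by (intro that[of G]) (auto simp: A_def)
qed

lemma eventually_Inf_chain:
  assumes "C \<noteq> {}" "\<And>G H. G \<in> C \<Longrightarrow> H \<in> C \<Longrightarrow> G \<le> H \<or> H \<le> G"
  shows "eventually P (Inf C) \<longleftrightarrow> (\<exists>G\<in>C. eventually P G)"
proof (rule eventually_Inf_base[OF assms(1)])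
  fix G H assume "G \<in> C" "H \<in> C"
  then show "\<exists>K\<in>C. K \<le> inf G H"
    using assms(2)[of G H] by (metis inf_greatest order_refl)
qed

lemma Inf_chain_neq_bot:
  fixes C :: "'a filter set"
  assumes "C \<noteq> {}" "\<And>G H. G \<in> C \<Longrightarrow> H \<in> C \<Longrightarrow> G \<le> H \<or> H \<le> G" "bot \<notin> C"
  shows "Inf C \<noteq> bot"
  using assms(3) eventually_Inf_chain[OF assms(1,2), of "\<lambda>_. False"]
  by (metis trivial_limit_def)

text \<open>If the complement of \<open>P\<close> is not in a minimal proper filter, adjoining
  \<open>P\<close> keeps the filter proper, so by minimality \<open>P\<close> was already in
  it.\<close>

lemma ultrafilter_exists:
  assumes "F \<noteq> bot"
  obtains U where "U \<le> F" "ultrafilter U"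
proof -
  obtain U where U: "U \<le> F" "U \<noteq> bot" "\<And>H. H \<le> U \<Longrightarrow> H \<noteq> bot \<Longrightarrow> H = U"
  proof (rule minimal_filter_exists[of "\<lambda>F. F \<noteq> bot", OF assms])
    show "Inf C \<noteq> bot" if "C \<noteq> {}" "\<And>G H. G \<in> C \<Longrightarrow> H \<in> C \<Longrightarrow> G \<le> H \<or> H \<le> G"
      "\<And>G. G \<in> C \<Longrightarrow> G \<noteq> bot" for C :: "'a filter set"
      using Inf_chain_neq_bot[OF that(1,2)] that(3) by blast
  qed blast
  have "eventually P U \<or> eventually (\<lambda>x. \<not> P x) U" for P
  proof (rule disjCI)
    assume "\<not> eventually (\<lambda>x. \<not> P x) U"
    then have "inf U (principal {x. P x}) \<noteq> bot"
      by (simp add: trivial_limit_def eventually_inf_principal)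
    then have "inf U (principal {x. P x}) = U" using U(3) by simp
    moreover have "eventually P (inf U (principal {x. P x}))"
      by (simp add: eventually_inf_principal)
    ultimately show "eventually P U" by simp
  qed
  then show thesis using U(1,2) that by (auto simp: ultrafilter_def)
qed

text \<open>The condition is \<open>filter_conv f F F \<le> F\<close>. It makes the set of
  ultrafilters below \<open>F\<close> closed under products; for an ultrafilter it means being an
  idempotent.\<close>

definition idempotent_filter :: "('a \<Rightarrow> 'a \<Rightarrow> 'a) \<Rightarrow> 'a filter \<Rightarrow> bool" where
  "idempotent_filter f F \<longleftrightarrow>
    (\<forall>P. eventually P F \<longrightarrow> eventually (\<lambda>s. eventually (\<lambda>t. P (f s t)) F) F)"

text \<open>On ultrafilters this is the product of the Stone-Cech compactification of the discrete
  semigroup.\<close>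

definition filter_conv :: "('a \<Rightarrow> 'a \<Rightarrow> 'a) \<Rightarrow> 'a filter \<Rightarrow> 'a filter \<Rightarrow> 'a filter" where
  "filter_conv f F G = Abs_filter (\<lambda>P. eventually (\<lambda>s. eventually (\<lambda>t. P (f s t)) G) F)"

lemma eventually_filter_conv:
  "eventually P (filter_conv f F G) \<longleftrightarrow> eventually (\<lambda>s. eventually (\<lambda>t. P (f s t)) G) F"
  unfolding filter_conv_def
proof (rule eventually_Abs_filter, rule is_filter.intro)
  fix P Q
  assume "eventually (\<lambda>s. eventually (\<lambda>t. P (f s t)) G) F"
    "eventually (\<lambda>s. eventually (\<lambda>t. Q (f s t)) G) F"
  then show "eventually (\<lambda>s. eventually (\<lambda>t. P (f s t) \<and> Q (f s t)) G) F"
    by eventually_elim (rule eventually_conj)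
next
  fix P Q
  assume "\<forall>x. P x \<longrightarrow> Q x" "eventually (\<lambda>s. eventually (\<lambda>t. P (f s t)) G) F"
  then show "eventually (\<lambda>s. eventually (\<lambda>t. Q (f s t)) G) F"
    by (auto elim!: eventually_mono)
qed simp

text \<open>
  Ellis's lemma with filters in place of closed sets of ultrafilters: a minimal element \<open>E\<close> of the
  idempotent proper filters is an ultrafilter.  For an ultrafilter \<open>U \<le> E\<close>, minimality first gives
  \<open>E * U = E\<close>, and then that \<open>E\<close> contains the stabilizer filter of \<open>U\<close>, generated by the sets
  \<open>{s. \<forall>\<^sub>F t in U. A (s * t)}\<close> for \<open>A\<close> in \<open>U\<close>.
\<close>

lemma idempotent_ultrafilter_exists:
  assumes "semigroup f" and F: "idempotent_filter f F" "F \<noteq> bot"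
  obtains U where "U \<le> F" "ultrafilter U" "idempotent_filter f U"
proof -
  have assoc: "f (f a b) c = f a (f b c)" for a b c
    using assms(1) by (simp add: semigroup_def)
  obtain E where E: "E \<le> F" "idempotent_filter f E" "E \<noteq> bot"
    and min: "\<And>H. H \<le> E \<Longrightarrow> idempotent_filter f H \<Longrightarrow> H \<noteq> bot \<Longrightarrow> H = E"
  proof (rule minimal_filter_exists[of "\<lambda>F. idempotent_filter f F \<and> F \<noteq> bot" F])
    fix C :: "'a filter set"
    assume C: "C \<noteq> {}" "\<And>G H. G \<in> C \<Longrightarrow> H \<in> C \<Longrightarrow> G \<le> H \<or> H \<le> G"
      "\<And>G. G \<in> C \<Longrightarrow> idempotent_filter f G \<and> G \<noteq> bot"
    have "eventually (\<lambda>s. eventually (\<lambda>t. P (f s t)) (Inf C)) (Inf C)"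
      if P: "eventually P (Inf C)" for P
    proof -
      obtain G where G: "G \<in> C" "eventually P G"
        using P eventually_Inf_chain[OF C(1,2)] by blast
      then have ev: "eventually (\<lambda>s. eventually (\<lambda>t. P (f s t)) G) G"
        using C(3) by (auto simp: idempotent_filter_def)
      have "Inf C \<le> G" using G(1) by (rule Inf_lower)
      note le = filter_leD[OF this]
      from ev show ?thesis by (intro le, elim eventually_mono) (rule le)
    qed
    then have "idempotent_filter f (Inf C)" by (simp add: idempotent_filter_def)
    moreover have "Inf C \<noteq> bot" using C by (intro Inf_chain_neq_bot) auto
    ultimately show "idempotent_filter f (Inf C) \<and> Inf C \<noteq> bot" by blast
  qed (use F in auto)
  have idem: "eventually (\<lambda>s. eventually (\<lambda>t. P (f s t)) E) E" if "eventually P E" for P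
    using E(2) that by (simp add: idempotent_filter_def)
  obtain U where U: "U \<le> E" "ultrafilter U" using ultrafilter_exists[OF E(3)] .
  have U_bot: "U \<noteq> bot" and U_ultra: "\<And>P. \<not> eventually P U \<Longrightarrow> eventually (\<lambda>x. \<not> P x) U"
    using U(2) by (auto simp: ultrafilter_def)
  note EU = filter_leD[OF U(1)]

  have conv: "filter_conv f E U = E"
  proof (rule min)
    show "filter_conv f E U \<le> E"
    proof (rule filter_leI)
      fix P assume "eventually P E"
      from idem[OF this] show "eventually P (filter_conv f E U)"
        unfolding eventually_filter_conv by (rule eventually_mono) (rule EU)
    qed
    show "filter_conv f E U \<noteq> bot"
      using E(3) U_bot
      by (simp add: trivial_limit_def eventually_filter_conv)
    show "idempotent_filter f (filter_conv f E U)"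
      unfolding idempotent_filter_def
    proof (intro allI impI)
      fix P assume "eventually P (filter_conv f E U)"
      from idem[OF this[unfolded eventually_filter_conv]]
      have 1: "eventually (\<lambda>s. eventually (\<lambda>t. eventually (\<lambda>u. P (f (f s t) u)) U) E) E" .
      \<comment> \<open>By associativity \<open>(s r) (t u)\<close> is \<open>(s (r t)) u\<close>,
        so idempotence of \<open>E\<close> applies to the factor \<open>f r t\<close>; the
        quantifier over \<open>r\<close> then passes from \<open>E\<close> to
        \<open>U\<close>.\<close>
      have "eventually (\<lambda>s. eventually (\<lambda>r. eventually (\<lambda>t. eventually (\<lambda>u. P (f (f s r) (f t u))) U) E) U) E"
      proof (rule eventually_mono[OF 1])
        fix s assume "eventually (\<lambda>t. eventually (\<lambda>u. P (f (f s t) u)) U) E"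
        from idem[OF this]
        show "eventually (\<lambda>r. eventually (\<lambda>t. eventually (\<lambda>u. P (f (f s r) (f t u))) U) E) U"
          by (intro EU) (simp add: assoc)
      qed
      then show "eventually (\<lambda>s. eventually (\<lambda>t. P (f s t)) (filter_conv f E U)) (filter_conv f E U)"
        by (simp add: eventually_filter_conv)
    qed
  qed

  define T where "T A s \<longleftrightarrow> eventually (\<lambda>t. A (f s t)) U" for A s
  \<comment> \<open>\<open>H\<close> is the infimum of \<open>E\<close> and the stabilizer filter.
    It is closed under conjunction because intersecting \<open>A\<close> and \<open>B\<close>
    intersects \<open>T A\<close> and \<open>T B\<close>.\<close>
  define H where
    "H = Abs_filter (\<lambda>X. \<exists>A. eventually A U \<and> eventually (\<lambda>s. T A s \<longrightarrow> X s) E)"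
  have ev_H: "eventually X H \<longleftrightarrow> (\<exists>A. eventually A U \<and> eventually (\<lambda>s. T A s \<longrightarrow> X s) E)" for X
    unfolding H_def
  proof (rule eventually_Abs_filter, rule is_filter.intro)
    fix P Q
    assume "\<exists>A. eventually A U \<and> eventually (\<lambda>s. T A s \<longrightarrow> P s) E"
      "\<exists>A. eventually A U \<and> eventually (\<lambda>s. T A s \<longrightarrow> Q s) E"
    then obtain A B where AB: "eventually A U" "eventually (\<lambda>s. T A s \<longrightarrow> P s) E"
      "eventually B U" "eventually (\<lambda>s. T B s \<longrightarrow> Q s) E" by blast
    have "eventually (\<lambda>s. T (\<lambda>t. A t \<and> B t) s \<longrightarrow> P s \<and> Q s) E"
      using AB(2,4) by eventually_elim (simp add: T_def eventually_conj_iff)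
    then show "\<exists>A. eventually A U \<and> eventually (\<lambda>s. T A s \<longrightarrow> P s \<and> Q s) E"
      using AB(1,3) by (intro exI[of _ "\<lambda>t. A t \<and> B t"]) (simp add: eventually_conj_iff)
  next
    fix P Q
    assume "\<forall>x. P x \<longrightarrow> Q x" "\<exists>A. eventually A U \<and> eventually (\<lambda>s. T A s \<longrightarrow> P s) E"
    then show "\<exists>A. eventually A U \<and> eventually (\<lambda>s. T A s \<longrightarrow> Q s) E"
      by (auto elim!: eventually_mono)
  qed (auto intro: exI[of _ "\<lambda>_. True"])
  have "H = E"
  proof (rule min)
    show "H \<le> E"
      by (rule filter_leI) (auto simp: ev_H intro!: exI[of _ "\<lambda>_. True"] elim: eventually_mono)
    show "H \<noteq> bot"
    proof
      assume "H = bot"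
      then have "eventually (\<lambda>_. False) H" by simp
      then obtain A where A: "eventually A U" "eventually (\<lambda>s. \<not> T A s) E"
        by (auto simp: ev_H)
      \<comment> \<open>If \<open>T A\<close> fails almost everywhere in \<open>E\<close>, the
        ultrafilter property puts the complement of \<open>A\<close> into \<open>E * U\<close>,
        hence into \<open>E\<close> and \<open>U\<close>.\<close>
      have "eventually (\<lambda>s. eventually (\<lambda>t. \<not> A (f s t)) U) E"
        using A(2) by (rule eventually_mono) (simp add: T_def U_ultra)
      then have "eventually (\<lambda>t. \<not> A t) (filter_conv f E U)" by (simp add: eventually_filter_conv)
      then have "eventually (\<lambda>t. \<not> A t) U" unfolding conv by (rule EU)
      with A(1) have "eventually (\<lambda>_. False) U" by eventually_elim simp
      then show False using U_bot by (simp add: trivial_limit_def)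
    qed
    show "idempotent_filter f H"
      unfolding idempotent_filter_def
    proof (intro allI impI)
      fix X assume "eventually X H"
      then obtain A where A: "eventually A U" "eventually (\<lambda>s. T A s \<longrightarrow> X s) E"
        by (auto simp: ev_H)
      have "eventually (\<lambda>s. T A s \<longrightarrow> eventually (\<lambda>t. X (f s t)) H) E"
        using idem[OF A(2)]
      proof eventually_elim
        case (elim s)
        show ?case
        proof
          assume "T A s"
          then show "eventually (\<lambda>t. X (f s t)) H"
            unfolding ev_H using elim
            \<comment> \<open>The translate of \<open>A\<close> by \<open>s\<close> is in
              \<open>U\<close> because \<open>T A s\<close> holds, and its \<open>T\<close>-set at
              \<open>t\<close> is \<open>T A (f s t)\<close> by associativity.\<close>
            by (intro exI[of _ "\<lambda>t. A (f s t)"]) (simp add: T_def assoc)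
        qed
      qed
      with A(1) show "eventually (\<lambda>s. eventually (\<lambda>t. X (f s t)) H) H"
        unfolding ev_H[of "\<lambda>s. eventually (\<lambda>t. X (f s t)) H"] by (intro exI conjI)
    qed
  qed
  have "E \<le> U"
  proof (rule filter_leI)
    fix A assume A: "eventually A U"
    then have "eventually (T A) H" by (auto simp: ev_H)
    then have "eventually A (filter_conv f E U)"
      unfolding \<open>H = E\<close> by (simp add: eventually_filter_conv T_def[abs_def])
    then show "eventually A E" by (simp add: conv)
  qed
  with U(1) have "U = E" by simp
  with E U show thesis using that by blast
qed

section \<open>A Nash-Williams theorem for block sequences\<close>

lemma infinite_collection_blt:
  assumes "infinite_collection D" "i < j"
  shows "\<forall>x\<in>D i. \<forall>y\<in>D j. x < y"
  using assms(2)
proof (induction j)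
  case (Suc j)
  have D: "finite (D k)" "D k \<noteq> {}" for k
    using assms(1) by (auto simp: infinite_collection_def block_def)
  have step: "\<forall>x\<in>D j. \<forall>y\<in>D (Suc j). x < y"
    using assms(1) D by (auto simp: infinite_collection_def blt_iff)
  show ?case
  proof (cases "i = j")
    case False
    then have IH: "\<forall>x\<in>D i. \<forall>y\<in>D j. x < y" using Suc by simp
    obtain z where "z \<in> D j" using D(2) by blast
    then show ?thesis using IH step by (metis less_trans)
  qed (use step in simp)
qed simp

lemma in_FU_imageE:
  assumes "s \<in> FU (D ` A)"
  obtains I where "I \<subseteq> A" "finite I" "I \<noteq> {}" "s = \<Union> (D ` I)"
proof -
  obtain E where E: "s = \<Union> E" "E \<subseteq> D ` A" "finite E" "E \<noteq> {}"
    using assms by (auto simp: FU_def)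
  then obtain I where "I \<subseteq> A" "finite I" "E = D ` I"
    by (meson finite_subset_image)
  with E that show thesis by blast
qed

lemma FU_imageI: "I \<subseteq> A \<Longrightarrow> finite I \<Longrightarrow> I \<noteq> {} \<Longrightarrow> \<Union> (D ` I) \<in> FU (D ` A)"
  unfolding FU_def by (blast intro: finite_imageI)

lemma FU_Un: "s \<in> FU C \<Longrightarrow> t \<in> FU C \<Longrightarrow> s \<union> t \<in> FU C"
proof -
  assume "s \<in> FU C" "t \<in> FU C"
  then obtain E E' where "s = \<Union> E" "E \<subseteq> C" "finite E" "E \<noteq> {}"
    "t = \<Union> E'" "E' \<subseteq> C" "finite E'" "E' \<noteq> {}" by (auto simp: FU_def)
  then have "s \<union> t = \<Union> (E \<union> E')" "E \<union> E' \<subseteq> C" "finite (E \<union> E')" "E \<union> E' \<noteq> {}" by auto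
  then show ?thesis unfolding FU_def mem_Collect_eq by (intro exI conjI)
qed

lemma FU_block:
  assumes "\<forall>s\<in>C. block s" "t \<in> FU C"
  shows "block t"
proof -
  obtain E where E: "t = \<Union> E" "E \<subseteq> C" "finite E" "E \<noteq> {}"
    using assms(2) by (auto simp: FU_def)
  then obtain s where s: "s \<in> E" by blast
  have blocks: "finite u \<and> u \<noteq> {} \<and> u \<subseteq> {1..}" if "u \<in> E" for u
    using that E(2) assms(1) by (auto simp: block_def)
  then have "finite t" "t \<subseteq> {1..}" using E(1,3) by auto
  moreover have "t \<noteq> {}" using blocks[OF s] s E(1) by blast
  ultimately show ?thesis by (simp add: block_def)
qed

section \<open>The filter generated by the tails of \<open>FU\<close>\<close>

definition FU_tail_filter :: "(nat \<Rightarrow> nat set) \<Rightarrow> nat set filter" where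
  "FU_tail_filter D = (INF n. principal {s \<in> FU (range D). \<forall>x\<in>s. n < x})"

lemma eventually_FU_tail_filter:
  "eventually P (FU_tail_filter D) \<longleftrightarrow> (\<exists>n. \<forall>s\<in>FU (range D). (\<forall>x\<in>s. n < x) \<longrightarrow> P s)"
  unfolding FU_tail_filter_def
proof (subst eventually_INF_base)
  fix m n :: nat
  show "\<exists>k\<in>UNIV. principal {s \<in> FU (range D). \<forall>x\<in>s. k < x}
    \<le> inf (principal {s \<in> FU (range D). \<forall>x\<in>s. m < x}) (principal {s \<in> FU (range D). \<forall>x\<in>s. n < x})"
    by (intro bexI[of _ "max m n"]) auto
qed (auto simp: eventually_principal)

text \<open>Each tail of \<open>FU\<close> is closed under union, so one bound \<open>n\<close>
  serves both factors.\<close>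

lemma idempotent_FU_tail_filter:
  assumes "infinite_collection D"
  shows "idempotent_filter (\<union>) (FU_tail_filter D)"
  unfolding idempotent_filter_def eventually_FU_tail_filter
proof (intro allI impI)
  fix P assume "\<exists>n. \<forall>s\<in>FU (range D). (\<forall>x\<in>s. n < x) \<longrightarrow> P s"
  then obtain n where "\<forall>s\<in>FU (range D). (\<forall>x\<in>s. n < x) \<longrightarrow> P s" by blast
  then have "\<forall>s\<in>FU (range D). (\<forall>x\<in>s. n < x) \<longrightarrow>
      (\<forall>t\<in>FU (range D). (\<forall>x\<in>t. n < x) \<longrightarrow> P (s \<union> t))"
    using FU_Un by (metis UnE)
  then show "\<exists>n. \<forall>s\<in>FU (range D). (\<forall>x\<in>s. n < x) \<longrightarrow>
      (\<exists>n. \<forall>t\<in>FU (range D). (\<forall>x\<in>t. n < x) \<longrightarrow> P (s \<union> t))"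
    by blast
qed

lemma FU_tail_filter_neq_bot:
  assumes "infinite_collection D"
  shows "FU_tail_filter D \<noteq> bot"
proof -
  have D: "D n \<noteq> {}" for n using assms by (auto simp: infinite_collection_def block_def)
  have "\<exists>s\<in>FU (range D). \<forall>x\<in>s. n < x" for n
  proof -
    have "\<forall>x\<in>D n. n \<le> x" for n
    proof (induction n)
      case (Suc n)
      obtain y where "y \<in> D n" using D[of n] by blast
      then have "n \<le> y \<and> (\<forall>x\<in>D (Suc n). y < x)"
        using Suc infinite_collection_blt[OF assms, of n "Suc n"] by simp
      then show ?case by auto
    qed simp
    then have "\<forall>x\<in>D (Suc n). n < x" by (meson Suc_le_lessD)
    moreover have "D (Suc n) \<in> FU (range D)" using FU_imageI[of "{Suc n}" UNIV D] by simp
    ultimately show ?thesis by blast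
  qed
  then show ?thesis by (simp add: trivial_limit_def eventually_FU_tail_filter) 
qed

text \<open>
  Galvin's construction: \<open>D n\<close> is chosen so that appending it, or merging it into the last block,
  preserves \<open>good\<close> for the finitely many collections formed from the earlier terms.
\<close>

lemma homogeneous_collection_exists:
  assumes D\<^sub>0: "infinite_collection D\<^sub>0"
    and U: "U \<le> FU_tail_filter D\<^sub>0" "idempotent_filter (\<union>) U" "U \<noteq> bot"
    and Q: "Q []" "\<And>ss. Q ss \<Longrightarrow> eventually (\<lambda>t. Q (ss @ [t])) U"
  obtains D where "infinite_collection D" "refines D D\<^sub>0" "\<forall>ss\<in>finite_collections_in D. Q ss"
proof -
  \<comment> \<open>The second clause keeps the last block open: almost every later merge into it
    must again satisfy \<open>Q\<close>.\<close>
  define good where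
    "good ss \<longleftrightarrow> Q ss \<and> (ss \<noteq> [] \<longrightarrow> eventually (\<lambda>t. Q (butlast ss @ [last ss \<union> t])) U)" for ss
  have idem: "eventually (\<lambda>s. eventually (\<lambda>t. P (s \<union> t)) U) U" if "eventually P U" for P
    using U(2) that by (simp add: idempotent_filter_def)
  have good_append: "eventually (\<lambda>t. good (ss @ [t])) U" if "good ss" for ss
  proof -
    have 1: "eventually (\<lambda>t. Q (ss @ [t])) U" using that Q(2) by (simp add: good_def)
    \<comment> \<open>Idempotence of \<open>U\<close> keeps the new block open: for almost all
      \<open>s\<close>, almost all enlargements \<open>s \<union> t\<close> still satisfy
      \<open>Q\<close>.\<close>
    then have "eventually (\<lambda>s. eventually (\<lambda>t. Q (ss @ [s \<union> t])) U) U"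
      by (rule idem)
    with 1 show ?thesis by eventually_elim (simp add: good_def)
  qed
  have good_merge: "eventually (\<lambda>t. good (butlast ss @ [last ss \<union> t])) U" if "good ss" "ss \<noteq> []" for ss
  proof -
    have 1: "eventually (\<lambda>t. Q (butlast ss @ [last ss \<union> t])) U" using that by (simp add: good_def)
    then have "eventually (\<lambda>s. eventually (\<lambda>t. Q (butlast ss @ [last ss \<union> (s \<union> t)])) U) U"
      by (rule idem)
    with 1 show ?thesis by eventually_elim (simp add: good_def Un_assoc)
  qed
  have block: "block s" if "s \<in> FU (range D\<^sub>0)" for s
    using that D\<^sub>0 by (intro FU_block[of "range D\<^sub>0"]) (auto simp: infinite_collection_def)
  define ext where "ext d S =
      S \<union> (\<lambda>ss. ss @ [d]) ` S \<union> (\<lambda>ss. butlast ss @ [last ss \<union> d]) ` (S - {[]})"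
    for d :: "nat set" and S
  define inv where "inv = (\<lambda>(d, S). d \<in> FU (range D\<^sub>0) \<and> finite S \<and> (\<forall>ss\<in>S. good ss))"
  have step: "\<exists>y. inv y \<and> blt (fst x) (fst y) \<and> snd y = ext (fst y) (snd x)" if "inv x" for x
  proof -
    obtain d S where x: "x = (d, S)" by (cases x)
    have d: "d \<in> FU (range D\<^sub>0)" and S: "finite S" "\<forall>ss\<in>S. good ss"
      using that by (auto simp: x inv_def)
    have "eventually (\<lambda>t. \<forall>ss\<in>S. good (ss @ [t])) U"
      using S good_append by (simp add: eventually_ball_finite_distrib)
    moreover have "eventually (\<lambda>t. \<forall>ss\<in>S - {[]}. good (butlast ss @ [last ss \<union> t])) U"
      using S good_merge by (simp add: eventually_ball_finite_distrib)
    moreover have "eventually (\<lambda>t. t \<in> FU (range D\<^sub>0) \<and> (\<forall>x\<in>t. Max d < x)) U"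
      by (rule filter_leD[OF U(1)]) (auto simp: eventually_FU_tail_filter)
    ultimately have "eventually (\<lambda>t. (\<forall>ss\<in>S. good (ss @ [t])) \<and>
        (\<forall>ss\<in>S - {[]}. good (butlast ss @ [last ss \<union> t])) \<and>
        t \<in> FU (range D\<^sub>0) \<and> (\<forall>x\<in>t. Max d < x)) U"
      by eventually_elim blast
    then obtain t where t: "\<forall>ss\<in>S. good (ss @ [t])"
      "\<forall>ss\<in>S - {[]}. good (butlast ss @ [last ss \<union> t])"
      "t \<in> FU (range D\<^sub>0)" "\<forall>x\<in>t. Max d < x"
      using eventually_happens'[OF U(3)] by blast
    have "blt d t" using t(3,4) block[OF t(3)] by (auto simp: blt_def block_def)
    moreover have "inv (t, ext t S)" using S t by (auto simp: inv_def ext_def)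
    ultimately show ?thesis by (intro exI[of _ "(t, ext t S)"]) (simp add: x)
  qed
  \<comment> \<open>The block \<open>D\<^sub>0 0\<close> only bounds the first choice from below;
    \<open>D\<close> starts at \<open>f 1\<close>, so \<open>S n\<close> is built from the terms
    \<open>D i\<close> with \<open>i < n\<close>.\<close>
  have "inv (D\<^sub>0 0, {[]})"
    using FU_imageI[of "{0}" UNIV D\<^sub>0] Q(1) by (simp add: inv_def good_def)
  then have "\<exists>f. \<forall>n. (inv (f n) \<and> (n = 0 \<longrightarrow> f n = (D\<^sub>0 0, {[]}))) \<and>
      (blt (fst (f n)) (fst (f (Suc n))) \<and> snd (f (Suc n)) = ext (fst (f (Suc n))) (snd (f n)))"
    using step by (intro dependent_nat_choice) auto
  then obtain f where f: "f 0 = (D\<^sub>0 0, {[]})" "\<And>n. inv (f n)"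
    "\<And>n. blt (fst (f n)) (fst (f (Suc n))) \<and> snd (f (Suc n)) = ext (fst (f (Suc n))) (snd (f n))"
    by blast
  define D where "D n = fst (f (Suc n))" for n
  define S where "S n = snd (f n)" for n
  have S: "S 0 = {[]}" "\<And>n. S (Suc n) = ext (D n) (S n)" "\<And>n ss. ss \<in> S n \<Longrightarrow> Q ss"
    using f by (auto simp: S_def D_def inv_def good_def case_prod_beta)
  have D_FU: "D n \<in> FU (range D\<^sub>0)" for n
    using f(2)[of "Suc n"] by (simp add: D_def inv_def case_prod_beta)
  have D: "infinite_collection D"
    using D_FU block f(3) by (auto simp: infinite_collection_def D_def)
  have D_ne: "D n \<noteq> {}" for n using block[OF D_FU] by (auto simp: block_def)
  \<comment> \<open>Induction on \<open>n\<close> by the last block \<open>t\<close>, the only one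
    that can contain \<open>D n\<close>: it avoids \<open>D n\<close>, equals it, or is its union
    with earlier terms.\<close>
  have mem_S: "ss \<in> S n" if "ss \<in> finite_collections" "set ss \<subseteq> FU (D ` {..<n})" for ss n
    using that
  proof (induction n arbitrary: ss)
    case 0
    have "FU (D ` {..<0}) = {}" by (simp add: FU_def)
    with 0 show ?case by (simp add: S)
  next
    case (Suc n)
    show ?case
    proof (cases ss rule: rev_cases)
      case Nil
      then show ?thesis using Suc.IH[of "[]"] by (auto simp: S(2) ext_def finite_collections_def)
    next
      case (snoc us t)
      then have "t \<in> FU (D ` {..<Suc n})" using Suc.prems(2) by auto
      then obtain I where I: "I \<subseteq> {..<Suc n}" "finite I" "I \<noteq> {}" "t = \<Union> (D ` I)"
        by (rule in_FU_imageE)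
      have us: "us \<in> finite_collections" and blt: "\<And>u. u \<in> set us \<Longrightarrow> blt u t"
        and block: "\<And>u. u \<in> set us \<Longrightarrow> block u" "block t"
        using Suc.prems snoc by (auto simp: finite_collections_def sorted_wrt_append)
      have us_FU: "set us \<subseteq> FU (D ` {..<n})"
      proof
        fix u assume u: "u \<in> set us"
        then have "u \<in> FU (D ` {..<Suc n})" using Suc.prems(2) snoc by auto
        then obtain J where J: "J \<subseteq> {..<Suc n}" "finite J" "J \<noteq> {}" "u = \<Union> (D ` J)"
          by (rule in_FU_imageE)
        \<comment> \<open>Otherwise \<open>u\<close> would contain \<open>D n\<close>, although
          \<open>u\<close> precedes \<open>t\<close> and \<open>t\<close> contains some
          \<open>D i\<close> with \<open>i \<le> n\<close>.\<close>
        have "n \<notin> J"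
        proof
          assume "n \<in> J"
          obtain i where i: "i \<in> I" using I(3) by blast
          obtain x where x: "x \<in> D i" using D_ne by blast
          obtain y where y: "y \<in> D n" using D_ne by blast
          have "\<forall>a\<in>u. \<forall>b\<in>t. a < b"
            using blt[OF u] block u by (simp add: blt_iff block_def)
          then have less: "a < b" if "a \<in> D n" "b \<in> D i" for a b
            using that I(4) J(4) i \<open>n \<in> J\<close> by blast
          have "i < n \<or> i = n" using i I(1) by auto
          then show False
          proof
            assume "i < n"
            then show False using infinite_collection_blt[OF D, of i n] less[of y x] x y by force
          qed (use less y in blast)
        qed
        then have "J \<subseteq> {..<n}" using J(1) by (auto simp: less_Suc_eq)
        then show "u \<in> FU (D ` {..<n})" unfolding J(4) using J by (intro FU_imageI)
      qed
      show ?thesis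
      proof (cases "n \<in> I")
        case False
        then have "I \<subseteq> {..<n}" using I(1) by (auto simp: less_Suc_eq)
        then have "t \<in> FU (D ` {..<n})" unfolding I(4) using I by (intro FU_imageI)
        then have "ss \<in> S n" using us_FU snoc Suc by simp
        then show ?thesis by (simp add: S(2) ext_def)
      next
        case n: True
        show ?thesis
        proof (cases "I = {n}")
          case True
          then have "t = D n" using I(4) by simp
          moreover have "us \<in> S n" using us us_FU Suc.IH by simp
          ultimately show ?thesis by (simp add: S(2) ext_def snoc)
        next
          case False
          \<comment> \<open>\<open>v\<close> is \<open>t\<close> before \<open>D n\<close> was
            merged into it.\<close>
          define v where "v = \<Union> (D ` (I - {n}))"
          have "I - {n} \<subseteq> {..<n}" using I(1) by (auto simp: less_Suc_eq)
          moreover have "I - {n} \<noteq> {}" using False n by blast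
          ultimately have v: "v \<in> FU (D ` {..<n})" unfolding v_def using I(2) by (intro FU_imageI) auto
          have t: "t = v \<union> D n" using n I(4) by (auto simp: v_def)
          have "v \<noteq> {}" using \<open>I - {n} \<noteq> {}\<close> D_ne by (auto simp: v_def)
          then have "block v" using block(2) t by (auto simp: block_def)
          moreover have "blt u v" if "u \<in> set us" for u
            using blt[OF that] block that \<open>block v\<close> t by (auto simp: blt_iff block_def)
          ultimately have "us @ [v] \<in> finite_collections"
            using us by (auto simp: finite_collections_def sorted_wrt_append)
          then have "us @ [v] \<in> S n" using us_FU v Suc.IH by simp
          then have "butlast (us @ [v]) @ [last (us @ [v]) \<union> D n] \<in> S (Suc n)"
            unfolding S(2) ext_def by blast
          then show ?thesis by (simp add: snoc t)
        qed
      qed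
    qed
  qed
  show thesis
  proof
    show "refines D D\<^sub>0" using D_FU by (auto simp: refines_def)
    show "\<forall>ss\<in>finite_collections_in D. Q ss"
    proof
      fix ss assume ss: "ss \<in> finite_collections_in D"
      have "\<exists>n. set us \<subseteq> FU (D ` {..<n})" if "set us \<subseteq> FU (range D)" for us
        using that
      proof (induction us)
        case (Cons u us)
        then obtain n where n: "set us \<subseteq> FU (D ` {..<n})" by auto
        from Cons.prems have "u \<in> FU (range D)" by simp
        then obtain I where I: "finite I" "I \<noteq> {}" "u = \<Union> (D ` I)"
          by (rule in_FU_imageE)
        define k where "k = max n (Suc (Max I))"
        have "FU (D ` {..<n}) \<subseteq> FU (D ` {..<k})"
          unfolding FU_def k_def by fastforce
        moreover have "I \<subseteq> {..<k}" using I by (auto simp: k_def less_Suc_eq_le less_max_iff_disj)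
        then have "u \<in> FU (D ` {..<k})" unfolding I(3) using I by (intro FU_imageI)
        ultimately show ?case using n by (intro exI[of _ k]) auto
      qed simp
      with ss obtain n where "set ss \<subseteq> FU (D ` {..<n})"
        unfolding finite_collections_in_def by blast
      moreover have "ss \<in> finite_collections" using ss by (simp add: finite_collections_in_def)
      ultimately show "Q ss" by (intro S(3) mem_S)
    qed
  qed (rule D)
qed

section \<open>Acceptance and the dichotomy for thin families\<close>

text \<open>Taking the least such predicate gives every accepted collection a well-founded tree of
  extensions. The set \<open>T\<close> keeps the recursive premise monotone.\<close>

inductive accepts :: "'a filter \<Rightarrow> 'a list set \<Rightarrow> 'a list \<Rightarrow> bool" for U A where
  prefix: "us \<in> A \<Longrightarrow> prefix us ss \<Longrightarrow> accepts U A ss"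
| extend: "(\<And>t. t \<in> T \<Longrightarrow> accepts U A (ss @ [t])) \<Longrightarrow> eventually (\<lambda>t. t \<in> T) U \<Longrightarrow> accepts U A ss"

lemma accepts_append: "accepts U A ss \<Longrightarrow> eventually (\<lambda>t. accepts U A (ss @ [t])) U"
proof (induction rule: accepts.cases)
  case (prefix us ss)
  then have "accepts U A (ss @ [t])" for t by (auto intro!: accepts.prefix[of us])
  then show ?case using prefix by simp
next
  case (extend T ss)
  then show ?case by (auto elim: eventually_mono)
qed

text \<open>Sets in a proper filter are nonempty, so the tree can be followed to a leaf extending a
  member of \<open>A\<close>. On the way back, a prefix of \<open>ss @ [t]\<close> is either a
  prefix of \<open>ss\<close> or all of \<open>ss @ [t]\<close>.\<close>

lemma accepts_comparable:
  "accepts U A ss \<Longrightarrow> U \<noteq> bot \<Longrightarrow> \<exists>us\<in>A. prefix us ss \<or> prefix ss us"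
proof (induction rule: accepts.induct)
  case (extend T ss)
  then obtain t where "t \<in> T" using eventually_happens' by blast
  with extend obtain us where "us \<in> A" "prefix us (ss @ [t]) \<or> prefix (ss @ [t]) us" by blast
  then show ?case by (metis append_prefixD prefix_order.refl prefix_snoc)
qed blast

theorem nash_williams_block:
  assumes "infinite_collection D\<^sub>0"
    and thin: "\<And>ss us. ss \<in> B \<Longrightarrow> us \<in> B \<Longrightarrow> prefix ss us \<Longrightarrow> ss = us"
  obtains D where "infinite_collection D" "refines D D\<^sub>0"
    "B \<inter> finite_collections_in D \<subseteq> F \<or> B \<inter> finite_collections_in D \<inter> F = {}"
proof -
  obtain U where U: "U \<le> FU_tail_filter D\<^sub>0" "ultrafilter U" "idempotent_filter (\<union>) U"
    using idempotent_ultrafilter_exists[of "(\<union>)" "FU_tail_filter D\<^sub>0"]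
      idempotent_FU_tail_filter[OF assms(1)] FU_tail_filter_neq_bot[OF assms(1)]
    by (metis sup.semigroup_axioms)
  then have U_bot: "U \<noteq> bot" by (simp add: ultrafilter_def)
  let ?acc = "accepts U (F \<inter> B)"
  show thesis
  proof (cases "?acc []")
    case True
    obtain D where D: "infinite_collection D" "refines D D\<^sub>0" "\<forall>ss\<in>finite_collections_in D. ?acc ss"
      using homogeneous_collection_exists[where Q = ?acc, OF assms(1) U(1,3) U_bot True accepts_append] .
    have "B \<inter> finite_collections_in D \<subseteq> F"
    proof
      fix ss assume "ss \<in> B \<inter> finite_collections_in D"
      then show "ss \<in> F" using D(3) accepts_comparable[OF _ U_bot] thin by (metis IntD1 IntD2)
    qed
    with D that show thesis by blast
  next
    case False
    \<comment> \<open>The ultrafilter property enters here: if rejection is not almost sure,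
      acceptance is, and rule \<open>extend\<close> accepts \<open>ss\<close>.\<close>
    have rejects: "eventually (\<lambda>t. \<not> ?acc (ss @ [t])) U" if "\<not> ?acc ss" for ss
    proof (rule ccontr)
      assume "\<not> eventually (\<lambda>t. \<not> ?acc (ss @ [t])) U"
      then have "eventually (\<lambda>t. t \<in> {t. ?acc (ss @ [t])}) U"
        using U(2) by (auto simp: ultrafilter_def)
      then have "?acc ss" by (rule accepts.extend[rotated]) simp
      with that show False ..
    qed
    obtain D where D: "infinite_collection D" "refines D D\<^sub>0" "\<forall>ss\<in>finite_collections_in D. \<not> ?acc ss"
      using homogeneous_collection_exists[where Q = "\<lambda>ss. \<not> ?acc ss", OF assms(1) U(1,3) U_bot False rejects] .
    have "B \<inter> finite_collections_in D \<inter> F = {}"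
      using D(3) accepts.prefix[of _ "F \<inter> B"] by blast
    with D that show thesis by blast
  qed
qed

section \<open>Cantor normal forms\<close>

declare opow_omega_osuc [simp del]

section \<open>Addition of countable ordinals\<close>

lemma oadd_mono: "b \<le> c \<Longrightarrow> oadd a b \<le> oadd a c"
  using oadd_less[of b c a] by (auto simp: le_less)

lemma oadd_mono_left: "a \<le> b \<Longrightarrow> oadd a x \<le> oadd b x"
proof (induction x rule: less_induct)
  case (less x)
  have "oadd a c < oadd b x" if "c < x" for c
    using less(1)[OF that less(2)] oadd_less[OF that] by (rule le_less_trans)
  moreover have "a \<le> oadd b x"
    using less(2) oadd_ge by (rule order_trans)
  ultimately show ?case unfolding oadd_le_iff[of a x] by blast
qed

lemma oadd_left_cancel: "oadd a b = oadd a c \<longleftrightarrow> b = c"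
  by (metis neq_iff oadd_less)

lemma oadd_assoc: "oadd (oadd a b) c = oadd a (oadd b c)"
proof (induction c rule: less_induct)
  case (less c)
  show ?case
  proof (cases c rule: cord_cases)
    case (succ d)
    then show ?thesis using less[of d] by simp
  next
    case limit
    show ?thesis
    proof (rule antisym)
      show "oadd (oadd a b) c \<le> oadd a (oadd b c)"
        unfolding oadd_limit[OF limit, of "oadd a b"]
      proof (intro allI impI)
        fix d assume "d < c"
        then show "oadd (oadd a b) d \<le> oadd a (oadd b c)"
          using less oadd_less[of d c b] by (simp add: oadd_mono less_imp_le)
      qed
      have "oadd a d < oadd (oadd a b) c" if d: "d < oadd b c" for d
      proof -
        have "\<not> oadd b c \<le> d" using d by simp
        then obtain e where e: "e < c" "d < oadd b e"
          unfolding oadd_limit[OF limit, of b d] by (auto simp: not_le)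
        then have "oadd a d < oadd (oadd a b) e" using less by (simp add: oadd_less)
        also have "\<dots> < oadd (oadd a b) c" using e by (simp add: oadd_less)
        finally show ?thesis .
      qed
      moreover have "a \<le> oadd (oadd a b) c"
        using oadd_ge order_trans by blast
      ultimately show "oadd a (oadd b c) \<le> oadd (oadd a b) c"
        unfolding oadd_le_iff[of a "oadd b c"] by blast
    qed
  qed simp
qed

lemma oadd_ozero_left [simp]: "oadd ozero a = a"
proof (induction a rule: less_induct)
  case (less a)
  show ?case
  proof (rule cord_eqI)
    fix x
    have "oadd ozero a \<le> x \<longleftrightarrow> (\<forall>c<a. c < x)"
      using less by (simp add: oadd_le_iff[of ozero a])
    also have "\<dots> \<longleftrightarrow> a \<le> x"
      using not_le less_le_trans by blast
    finally show "oadd ozero a \<le> x \<longleftrightarrow> a \<le> x" .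
  qed
qed

section \<open>Finite multiples and powers of omega\<close>

lemma oadd_omul_ofin: "oadd a (omul a (ofin n)) = omul a (ofin (Suc n))"
  by (induction n) (simp_all flip: oadd_assoc)

lemma omul_ofin_less_omega: "ozero < a \<Longrightarrow> omul a (ofin n) < omul a omega"
proof -
  assume "ozero < a"
  then have "omul a (ofin n) < omul a (ofin (Suc n))" using oadd_less[of ozero a] by simp
  also have "\<dots> \<le> omul a omega"
    using omul_limit[OF is_limit_omega, of a "omul a omega"] less_omega_iff by blast
  finally show ?thesis .
qed

lemma less_omul_omegaD: "x < omul a omega \<Longrightarrow> \<exists>n. x < omul a (ofin n)"
  using omul_limit[OF is_limit_omega, of a x] less_omega_iff by (metis not_le)

lemma opow_omega_strict_mono: "a < b \<Longrightarrow> opow_omega a < opow_omega b"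
proof -
  assume "a < b"
  have "omul (opow_omega a) (ofin 1) < omul (opow_omega a) omega"
    using omul_ofin_less_omega opow_omega_pos by blast
  then have "opow_omega a < omul (opow_omega a) omega" by simp
  also have "\<dots> \<le> opow_omega b" using opow_omega_le_iff[of b "opow_omega b"] \<open>a < b\<close> by simp
  finally show ?thesis .
qed

lemma opow_omega_less_iff [simp]: "opow_omega a < opow_omega b \<longleftrightarrow> a < b"
  by (metis neq_iff order_less_asym opow_omega_strict_mono)

lemma opow_omega_inject [simp]: "opow_omega a = opow_omega b \<longleftrightarrow> a = b"
  by (metis neq_iff opow_omega_less_iff)

text \<open>\<open>opow_omega (osuc c)\<close> is the supremum of the finite multiples of
  \<open>opow_omega c\<close>, and adding \<open>opow_omega c\<close> on the left raises the
  multiplier by only one.\<close>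

lemma oadd_opow_omega_less:
  assumes "x < opow_omega (osuc c)"
  shows "oadd (opow_omega c) x < opow_omega (osuc c)"
proof -
  obtain n where "x < omul (opow_omega c) (ofin n)"
    using less_omul_omegaD assms by (auto simp: opow_omega_osuc)
  then have "oadd (opow_omega c) x < omul (opow_omega c) (ofin (Suc n))"
    using oadd_less oadd_omul_ofin by metis
  also have "\<dots> < opow_omega (osuc c)"
    unfolding opow_omega_osuc by (rule omul_ofin_less_omega[OF opow_omega_pos])
  finally show ?thesis .
qed

text \<open>If the power were \<open>osuc x\<close>, some finite multiple of
  \<open>opow_omega b\<close> would exceed \<open>x\<close> and so reach the power. With the next
  lemma this separates rule \<open>succ\<close> from the power rules.\<close>

lemma opow_omega_osuc_neq_osuc: "opow_omega (osuc b) \<noteq> osuc x"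
proof
  assume x: "opow_omega (osuc b) = osuc x"
  then have "x < omul (opow_omega b) omega" by (metis less_osuc opow_omega_osuc)
  then obtain n where "osuc x \<le> omul (opow_omega b) (ofin n)" using less_omul_omegaD by auto
  also have "\<dots> < opow_omega (osuc b)"
    unfolding opow_omega_osuc by (rule omul_ofin_less_omega[OF opow_omega_pos])
  finally show False using x by simp
qed

lemma opow_omega_limit_neq_osuc: "is_limit l \<Longrightarrow> opow_omega l \<noteq> osuc x"
proof
  assume l: "is_limit l" and x: "opow_omega l = osuc x"
  then have "\<not> opow_omega l \<le> x" by simp
  then obtain c where "c < l" "x < opow_omega c"
    unfolding opow_omega_limit[OF l] by (auto simp: not_le)
  then have "osuc x \<le> opow_omega c" "opow_omega c < opow_omega l" by simp_all
  then show False unfolding x by (metis le_less_trans less_irrefl)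
qed

section \<open>Normal forms and their uniqueness\<close>

text \<open>On weakly decreasing lists this is Cantor normal form, with each exponent repeated
  according to its coefficient. Exponents then correspond one to one to the Schreier sets in rule
  \<open>sum\<close>.\<close>

definition cantor :: "cord list \<Rightarrow> cord" where
  "cantor cs = foldr (\<lambda>c. oadd (opow_omega c)) cs ozero"

lemma cantor_simps [simp]:
  "cantor [] = ozero" "cantor (c # cs) = oadd (opow_omega c) (cantor cs)"
  by (simp_all add: cantor_def)

lemma cantor_less:
  "\<forall>d\<in>set cs. d \<le> c \<Longrightarrow> cantor cs < opow_omega (osuc c)"
proof (induction cs)
  case (Cons d cs)
  then have "opow_omega d \<le> opow_omega c" by (simp add: leD le_less)
  then have "cantor (d # cs) \<le> oadd (opow_omega c) (cantor cs)"
    by (simp add: oadd_mono_left)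
  also have "\<dots> < opow_omega (osuc c)"
    using Cons by (intro oadd_opow_omega_less) simp
  finally show ?case .
qed (use opow_omega_pos in simp)

lemma cantor_eq_ozero_iff: "cantor cs = ozero \<longleftrightarrow> cs = []"
proof (cases cs)
  case (Cons c ds)
  have "ozero < cantor cs"
    unfolding Cons cantor_simps by (rule less_le_trans[OF opow_omega_pos oadd_ge])
  then show ?thesis using Cons by simp
qed simp

text \<open>The leading exponent \<open>c\<close> is determined because the value is at least
  \<open>opow_omega c\<close> and below \<open>opow_omega (osuc c)\<close>; the leading power then
  cancels from the left.\<close>

lemma cantor_inject:
  "sorted_wrt (\<ge>) cs \<Longrightarrow> sorted_wrt (\<ge>) ds \<Longrightarrow> cantor cs = cantor ds \<Longrightarrow> cs = ds"
proof (induction cs arbitrary: ds)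
  case Nil
  then show ?case by (metis cantor_eq_ozero_iff)
next
  case (Cons c cs)
  obtain d ds' where ds: "ds = d # ds'"
    using Cons.prems(3) by (metis cantor_eq_ozero_iff list.exhaust)
  have less: "opow_omega x \<le> cantor (x # xs)" "cantor (x # xs) < opow_omega (osuc x)"
    if "sorted_wrt (\<ge>) (x # xs)" for x xs
    using cantor_less[of "x # xs" x] that by (simp_all add: oadd_ge)
  have "opow_omega c < opow_omega (osuc d)" "opow_omega d < opow_omega (osuc c)"
    using less[of c cs] less[of d ds'] Cons.prems ds by (metis le_less_trans)+
  then have "c = d" by (simp add: less_osuc_iff)
  then have "cantor cs = cantor ds'" using Cons.prems ds by (simp add: oadd_left_cancel)
  then show ?case using Cons \<open>c = d\<close> ds by simp
qed

lemma funpow_oadd: "(oadd a ^^ n) x = oadd (omul a (ofin n)) x"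
proof (induction n arbitrary: x)
  case (Suc n)
  have "oadd a (oadd (omul a (ofin n)) x) = oadd (omul a (ofin (Suc n))) x"
    unfolding oadd_assoc[symmetric] oadd_omul_ofin ..
  then show ?case by (simp add: Suc)
qed simp

lemma foldr_concat_replicate_oadd:
  "foldr (\<lambda>c. oadd (opow_omega c)) (concat (map (\<lambda>i. replicate (p i) (a i)) is)) x =
    foldr (\<lambda>i x. oadd (omul (opow_omega (a i)) (ofin (p i))) x) is x"
  by (induction "is") (simp_all add: funpow_oadd)

section \<open>Thinness of the Schreier families\<close>

definition initial_segment :: "'a::linorder set \<Rightarrow> 'a set \<Rightarrow> bool" where
  "initial_segment s t \<longleftrightarrow> s \<subseteq> t \<and> (\<forall>x\<in>s. \<forall>y\<in>t. y < x \<longrightarrow> y \<in> s)"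

text \<open>Symmetric, so that an induction can descend to pieces of two sets without tracking which
  one is longer.\<close>

definition comparable :: "'a::linorder set \<Rightarrow> 'a set \<Rightarrow> bool" where
  "comparable s t \<longleftrightarrow> initial_segment s t \<or> initial_segment t s"

text \<open>Both \<open>s\<close> and \<open>s'\<close> are initial segments of the longer union,
  and two initial segments of one linearly ordered set are comparable.\<close>

lemma comparable_UnD:
  assumes "comparable (s \<union> t) (s' \<union> t')" "\<forall>x\<in>s. \<forall>y\<in>t. x < y" "\<forall>x\<in>s'. \<forall>y\<in>t'. x < y"
  shows "comparable s s'"
proof -
  have trans: "initial_segment u w" if "initial_segment u v" "initial_segment v w" for u v w :: "'a set"
    using that unfolding initial_segment_def by blast
  have Un: "initial_segment u (u \<union> v)" if "\<forall>x\<in>u. \<forall>y\<in>v. x < y" for u v :: "'a set"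
    using that unfolding initial_segment_def by (auto dest: order_less_asym)
  have comp: "comparable u v" if "initial_segment u w" "initial_segment v w" for u v w :: "'a set"
  proof (rule ccontr)
    assume "\<not> comparable u v"
    then have "\<not> u \<subseteq> v" "\<not> v \<subseteq> u"
      using that unfolding initial_segment_def comparable_def by blast+
    then obtain x y where "x \<in> u" "x \<notin> v" "y \<in> v" "y \<notin> u" by blast
    then show False using that unfolding initial_segment_def by (metis neq_iff subsetD)
  qed
  from assms(1) consider "initial_segment (s \<union> t) (s' \<union> t')" | "initial_segment (s' \<union> t') (s \<union> t)"
    by (auto simp: comparable_def)
  then show ?thesis
    using comp[OF trans[OF Un] Un] comp[OF Un trans[OF Un]] assms(2,3) by cases blast+
qed

lemma comparable_Un_cancel:
  assumes "comparable (s \<union> t) (s \<union> t')" "\<forall>x\<in>s. \<forall>y\<in>t. x < y" "\<forall>x\<in>s. \<forall>y\<in>t'. x < y"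
  shows "comparable t t'"
proof -
  have "initial_segment t t'" if "initial_segment (s \<union> t) (s \<union> t')"
    "\<forall>x\<in>s. \<forall>y\<in>t. x < y" "\<forall>x\<in>s. \<forall>y\<in>t'. x < y" for t t'
    unfolding initial_segment_def
  proof (intro conjI ballI impI subsetI)
    show "x \<in> t'" if "x \<in> t" for x
      using that \<open>initial_segment (s \<union> t) (s \<union> t')\<close> \<open>\<forall>x\<in>s. \<forall>y\<in>t. x < y\<close>
      by (auto simp: initial_segment_def)
    show "y \<in> t" if "x \<in> t" "y \<in> t'" "y < x" for x y
      using that \<open>initial_segment (s \<union> t) (s \<union> t')\<close> \<open>\<forall>x\<in>s. \<forall>y\<in>t'. x < y\<close>
      by (auto simp: initial_segment_def)
  qed
  then show ?thesis using assms unfolding comparable_def by blast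
qed

text \<open>A nonempty initial segment contains the least element of the whole set. Rules
  \<open>pow_succ\<close> and \<open>pow_limit\<close> depend on this minimum.\<close>

lemma comparable_MinD:
  assumes "comparable s t" "finite s" "finite t" "s \<noteq> {}" "t \<noteq> {}"
  shows "Min s = Min t"
proof -
  have "Min s = Min t" if "initial_segment s t" "finite s" "finite t" "s \<noteq> {}" for s t :: "'a set"
  proof (rule Min_eqI[symmetric])
    show "Min s \<in> t" using that Min_in[of s] unfolding initial_segment_def by blast
    fix y assume "y \<in> t"
    show "Min s \<le> y"
    proof (rule ccontr)
      assume "\<not> Min s \<le> y"
      then have "y \<in> s" using that \<open>y \<in> t\<close> Min_in[of s] by (auto simp: initial_segment_def not_le)
      then show False using \<open>\<not> Min s \<le> y\<close> that by simp
    qed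
  qed (use that in auto)
  then show ?thesis using assms unfolding comparable_def by metis
qed

text \<open>Blocks are peeled off from the left: the first two are comparable, hence equal by
  thinness, and cancelling them leaves comparable remainders. Thinness is asked of the members of
  \<open>ts\<close> only, as an induction over one derivation provides it there.\<close>

lemma comparable_Union_lists:
  assumes "list_all2 (\<lambda>t c. finite t \<and> P c t \<and> (\<forall>t'. P c t' \<longrightarrow> comparable t t' \<longrightarrow> t = t')) ts cs"
    and "list_all2 (\<lambda>t c. finite t \<and> P c t) us cs"
    and "sorted_wrt blt ts" "sorted_wrt blt us" "comparable (\<Union> (set ts)) (\<Union> (set us))"
  shows "ts = us"
  using assms
proof (induction ts cs arbitrary: us rule: list_all2_induct)
  case Nil
  then show ?case by simp
next
  case (Cons t ts c cs)
  from Cons.prems(1) obtain u us' where us: "us = u # us'" "finite u" "P c u"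
    "list_all2 (\<lambda>t c. finite t \<and> P c t) us' cs"
    by (auto simp: list_all2_Cons2)
  have fin: "\<forall>t\<in>set ts. finite t" "\<forall>t\<in>set us'. finite t"
    using Cons.hyps(2) us(4) by (auto simp: list_all2_conv_all_nth in_set_conv_nth)
  have t: "\<forall>x\<in>t. \<forall>y\<in>\<Union> (set ts). x < y" "\<forall>x\<in>u. \<forall>y\<in>\<Union> (set us'). x < y"
    using Cons.prems us(1,2) Cons.hyps(1) fin by (auto simp: blt_iff)
  have comp: "comparable (t \<union> \<Union> (set ts)) (u \<union> \<Union> (set us'))"
    using Cons.prems us by simp
  from comparable_UnD[OF comp t] have tu: "t = u" using Cons.hyps(1) us by blast
  have "comparable (\<Union> (set ts)) (\<Union> (set us'))"
    using comparable_Un_cancel[of u, OF comp[unfolded tu] t(1)[unfolded tu] t(2)] .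
  then have "ts = us'" using Cons us by simp
  then show ?case using us tu by simp
qed

text \<open>Rule \<open>sum\<close> puts the leading power rightmost, so the blocks read from left
  to right have weakly increasing exponents; hence \<open>rev cs\<close>. The abstract
  \<open>P\<close> covers both plain membership and membership with an induction hypothesis.\<close>

lemma sum_normal_form:
  fixes T :: "nat \<Rightarrow> nat set list"
  assumes "\<forall>i\<le>m. 1 \<le> (p i :: nat)" "\<forall>i<m. a (Suc i) < a i"
    and \<xi>: "\<xi> = foldr (\<lambda>i x. oadd (omul (opow_omega (a i)) (ofin (p i))) x) [0..<Suc m] ozero"
    and T: "\<forall>i\<le>m. length (T i) = p i \<and> sorted_wrt blt (T i) \<and> (\<forall>t\<in>set (T i). P (a i) t)"
    and blt: "\<forall>i<m. blt (\<Union> (set (T (Suc i)))) (\<Union> (set (T i)))"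
    and P: "\<forall>c t. P c t \<longrightarrow> finite t \<and> t \<noteq> {}"
  shows "\<exists>ts cs. (\<Union>i\<le>m. \<Union> (set (T i))) = \<Union> (set ts) \<and> \<xi> = cantor cs \<and>
    sorted_wrt (\<ge>) cs \<and> sorted_wrt blt ts \<and>
    list_all2 (\<lambda>t c. P c t) ts (rev cs)"
proof -
  define cs where "cs = concat (map (\<lambda>i. replicate (p i) (a i)) [0..<Suc m])"
  define ts where "ts = concat (map T (rev [0..<Suc m]))"
  have a: "a j \<le> a i" if "i \<le> j" "j \<le> m" for i j
    using that
  proof (induction j rule: dec_induct)
    case (step n)
    then have "a (Suc n) < a n" using assms(2) by simp
    also have "\<dots> \<le> a i" using step by simp
    finally show ?case by simp
  qed simp
  have "sorted_wrt (\<ge>) (concat (map (\<lambda>i. replicate (p i) (a i)) [0..<n]))" if "n \<le> Suc m" for n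
    using that
  proof (induction n)
    case (Suc n)
    have "sorted_wrt (\<ge>) (replicate k (a n))" for k by (induction k) auto
    then show ?case using Suc by (auto simp: sorted_wrt_append a)
  qed simp
  then have "sorted_wrt (\<ge>) cs" by (simp add: cs_def del: upt_Suc)
  moreover have "\<xi> = cantor cs"
    unfolding \<xi> cantor_def cs_def foldr_concat_replicate_oadd ..
  moreover have "list_all2 (\<lambda>t c. P c t) ts (rev cs)"
  proof -
    have "rev cs = concat (map (\<lambda>i. replicate (p i) (a i)) (rev [0..<Suc m]))"
      unfolding cs_def by (simp add: rev_concat rev_map comp_def del: upt_Suc)
    moreover have "list_all2 (\<lambda>t c. P c t) (concat (map T is))
        (concat (map (\<lambda>i. replicate (p i) (a i)) is))" if "set is \<subseteq> {..m}" for "is"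
      using that
    proof (induction "is")
      case (Cons i "is")
      have "i \<le> m" using Cons.prems by simp
      with T have "length (T i) = p i" "\<forall>t\<in>set (T i). P (a i) t" by blast+
      then have "list_all2 (\<lambda>t c. P c t) (T i) (replicate (p i) (a i))"
        by (simp add: list_all2_conv_all_nth)
      with Cons show ?case by (auto intro: list_all2_appendI)
    qed simp
    moreover have "set (rev [0..<Suc m]) \<subseteq> {..m}" by auto
    ultimately show ?thesis unfolding ts_def by metis
  qed
  moreover have "(\<Union>i\<le>m. \<Union> (set (T i))) = \<Union> (set ts)"
    unfolding ts_def by (simp add: atLeast0LessThan lessThan_Suc_atMost del: upt_Suc) blast
  moreover have "sorted_wrt blt ts"
  proof -
    have fin: "finite t" "t \<noteq> {}" if "t \<in> set (T i)" "i \<le> m" for t i using that T P by blast+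
    define R where "R i = \<Union> (set (T i))" for i
    have R: "finite (R i)" "R i \<noteq> {}" if "i \<le> m" for i
    proof -
      show "finite (R i)" using that fin by (auto simp: R_def)
      have "T i \<noteq> []" using that T assms(1) by force
      then obtain t where "t \<in> set (T i)" by (cases "T i") auto
      then show "R i \<noteq> {}" using that fin by (auto simp: R_def)
    qed
    have R_less: "\<forall>x\<in>R j. \<forall>y\<in>R i. x < y" if "i < j" "j \<le> m" for i j
      using that
    proof (induction j)
      case (Suc j)
      have step: "\<forall>x\<in>R (Suc j). \<forall>y\<in>R j. x < y"
        using blt[folded R_def] Suc.prems R(1)[of j] R(1)[of "Suc j"] by (metis Suc_le_lessD Suc_leD blt_iff)
      show ?case
      proof (cases "i = j")
        case False
        obtain z where "z \<in> R j" using R[of j] Suc.prems by auto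
        moreover have "\<forall>x\<in>R j. \<forall>y\<in>R i. x < y" using Suc False by simp
        ultimately show ?thesis using step by (metis less_trans)
      qed (use step in simp)
    qed simp
    have "sorted_wrt blt (concat (map T (rev [0..<n])))" if "n \<le> Suc m" for n
      using that
    proof (induction n)
      case (Suc n)
      have "blt t u" if tu: "t \<in> set (T n)" "u \<in> set (T i)" "i < n" for t u i
      proof -
        have "\<forall>x\<in>t. \<forall>y\<in>u. x < y" using R_less[of i n] Suc.prems tu by (auto simp: R_def)
        then show ?thesis using tu fin[of t n] fin[of u i] Suc.prems by (simp add: blt_iff)
      qed
      moreover have "sorted_wrt blt (T n)" using T Suc.prems by simp
      ultimately show ?case using Suc by (auto simp: sorted_wrt_append)
    qed simp
    from this[of "Suc m"] show ?thesis by (simp add: ts_def del: upt_Suc)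
  qed
  ultimately show ?thesis by (intro exI[of _ ts] exI[of _ cs] conjI)
qed

section \<open>Inversion of the rules for Schreier families\<close>

lemma opow_omega_neq_ozero [simp]: "opow_omega b \<noteq> ozero"
  using opow_omega_pos[of b] by auto

text \<open>The last conjunct makes all members of the power families nonempty, as powers of omega
  are not zero, so that they have minima.\<close>

lemma schreier_finite:
  "schreier L \<xi> s \<Longrightarrow> finite s \<and> s \<subseteq> {1..} \<and> (s = {} \<longrightarrow> \<xi> = ozero)"
proof (induction rule: schreier.induct)
  case (pow_succ ss \<beta>)
  then have "hd ss \<in> set ss" by simp
  then show ?case using pow_succ by auto
next
  case (sum \<xi> a m p T)
  have T: "finite t \<and> t \<subseteq> {1..} \<and> t \<noteq> {}" if "i \<le> m" "t \<in> set (T i)" for i t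
    using sum(11) that opow_omega_neq_ozero by blast
  have "length (T 0) \<noteq> 0" using sum(5,11) by (metis le0 not_one_le_zero)
  then have "hd (T 0) \<in> set (T 0)" by simp
  moreover obtain x where "x \<in> hd (T 0)"
    using T[OF le0 \<open>hd (T 0) \<in> set (T 0)\<close>] by blast
  ultimately have "x \<in> \<Union> (set (T 0))" by blast
  then have "x \<in> (\<Union>i\<le>m. \<Union> (set (T i)))" by (rule UN_I[of 0, rotated]) simp
  then have "(\<Union>i\<le>m. \<Union> (set (T i))) \<noteq> {}" unfolding ex_in_conv[symmetric] by (rule exI)
  moreover have "finite (\<Union>i\<le>m. \<Union> (set (T i)))" "(\<Union>i\<le>m. \<Union> (set (T i))) \<subseteq> {1..}"
    using T by auto
  ultimately show ?case by blast
qed auto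

text \<open>Here and in the next three lemmas the other rules are excluded by their indices:
  \<open>sum\<close> needs a limit strictly between consecutive powers, and the powers in
  \<open>pow_succ\<close> and \<open>pow_limit\<close> are not successors.\<close>

lemma schreier_osucE:
  assumes "schreier L (osuc \<zeta>) s"
  obtains n t where "s = insert n t" "schreier L \<zeta> t" "blt {n} t"
  using assms
proof (cases rule: schreier.cases)
  case (succ n \<zeta> s)
  then show ?thesis using that by simp
next
  case (sum a m p T)
  from sum(2) show ?thesis by (simp add: is_limit_def is_succ_def)
qed (metis less_osuc not_less_ozero, metis opow_omega_osuc_neq_osuc, metis opow_omega_limit_neq_osuc)

lemma schreier_pow_succE:
  assumes "schreier L (opow_omega (osuc \<beta>)) s"
  obtains ss where "s = \<Union> (set ss)" "ss \<noteq> []" "length ss = Min (hd ss)" "sorted_wrt blt ss"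
      "\<forall>t\<in>set ss. schreier L (opow_omega \<beta>) t"
  using assms
proof (cases rule: schreier.cases)
  case (pow_succ ss \<beta>)
  then show ?thesis using that by simp
next
  case (succ n \<zeta> s)
  from succ(1) show ?thesis using opow_omega_osuc_neq_osuc by blast
next
  case (pow_limit l)
  then show ?thesis by (auto simp: is_limit_def is_succ_def)
next
  case (sum a m p T)
  from sum(4,5) show ?thesis by (simp add: less_osuc_iff)
qed simp

lemma schreier_pow_limitE:
  assumes "schreier L (opow_omega l) s" "is_limit l"
  shows "schreier L (opow_omega (L l (Min s))) s"
  using assms
proof (cases rule: schreier.cases)
  case (succ n \<zeta> s)
  from succ(1) show ?thesis using opow_omega_limit_neq_osuc[OF assms(2)] by blast
next
  case (pow_succ ss \<beta>)
  from pow_succ(1) have "l = osuc \<beta>" by simp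
  then show ?thesis using assms(2) by (auto simp: is_limit_def is_succ_def)
next
  case (sum a m p T)
  from sum(4,5) show ?thesis by (simp add: less_osuc_iff)
qed simp_all

text \<open>Two derivations may a priori use different \<open>m\<close>, \<open>a\<close> and
  \<open>p\<close>; the exponent list \<open>cs\<close> replaces these data because
  \<open>cantor_inject\<close> makes it unique.\<close>

lemma schreier_sumE:
  assumes "schreier L \<xi> s" "is_limit \<xi>" "\<And>b. \<xi> \<noteq> opow_omega b"
  obtains ts cs where "s = \<Union> (set ts)" "\<xi> = cantor cs" "sorted_wrt (\<ge>) cs" "sorted_wrt blt ts"
    "list_all2 (\<lambda>t c. schreier L (opow_omega c) t) ts (rev cs)"
  using assms(1)
proof (cases rule: schreier.cases)
  case (sum a m p T)
  have fin: "\<forall>c t. schreier L (opow_omega c) t \<longrightarrow> finite t \<and> t \<noteq> {}"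
    using schreier_finite by fastforce
  obtain ts cs where "(\<Union>i\<le>m. \<Union> (set (T i))) = \<Union> (set ts)" "\<xi> = cantor cs" "sorted_wrt (\<ge>) cs"
    "sorted_wrt blt ts" "list_all2 (\<lambda>t c. schreier L (opow_omega c) t) ts (rev cs)"
    using sum_normal_form[where P = "\<lambda>c. schreier L (opow_omega c)" and T = T, OF sum(6,7,10,11,12) fin] by auto
  then show ?thesis using that sum(1) by simp
next
  case (succ n \<zeta> s)
  then show ?thesis using assms(2) by (auto simp: is_limit_def is_succ_def)
next
  case zero
  then show ?thesis using assms(2) by (simp add: is_limit_def)
qed (use assms(3) in blast)+

text \<open>Induction on the derivation of \<open>s\<close>; inversion shows that \<open>t\<close>
  arises by the same rule. Apart from \<open>zero\<close> and \<open>pow_limit\<close>, the rule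
  cuts both sets into consecutive pieces from the same smaller families, which are matched from the
  left.\<close>

lemma schreier_thin:
  "schreier L \<xi> s \<Longrightarrow> \<forall>t. schreier L \<xi> t \<longrightarrow> comparable s t \<longrightarrow> s = t"
proof (induction rule: schreier.induct)
  case zero
  have "t = {}" if "schreier L ozero t" for t
    using that
  proof (cases rule: schreier.cases)
    case (succ n \<zeta> s)
    then show ?thesis by (metis less_osuc not_less_ozero)
  next
    case (sum a m p T)
    from sum(2) show ?thesis by (simp add: is_limit_def)
  qed (metis opow_omega_neq_ozero)+
  then show ?case by blast
next
  case (succ n \<zeta> s)
  show ?case
  proof (intro allI impI)
    fix t assume "schreier L (osuc \<zeta>) t" and comp: "comparable ({n} \<union> s) t"
    then obtain k u where t: "t = insert k u" "schreier L \<zeta> u" "blt {k} u"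
      by (elim schreier_osucE)
    have less: "\<forall>x\<in>{n}. \<forall>y\<in>s. x < y" "\<forall>x\<in>{k}. \<forall>y\<in>u. x < y"
      using succ.hyps t schreier_finite by (metis blt_iff finite.emptyI finite_insert)+
    have comp': "comparable ({n} \<union> s) ({k} \<union> u)" using comp t by simp
    from comparable_UnD[OF comp' less] have "n = k"
      by (auto simp: comparable_def initial_segment_def)
    have "comparable s u"
      using comp' less unfolding \<open>n = k\<close> by (rule comparable_Un_cancel)
    then show "{n} \<union> s = t" using succ.IH t \<open>n = k\<close> by auto
  qed
next
  case (pow_succ ss \<beta>)
  show ?case
  proof (intro allI impI)
    fix t assume st: "schreier L (opow_omega (osuc \<beta>)) t" and comp: "comparable (\<Union> (set ss)) t"
    from st obtain us where us: "t = \<Union> (set us)" "us \<noteq> []" "length us = Min (hd us)"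
      "sorted_wrt blt us" "\<forall>t\<in>set us. schreier L (opow_omega \<beta>) t"
      by (rule schreier_pow_succE)
    have fin: "finite v \<and> v \<noteq> {}" if "schreier L (opow_omega \<beta>) v" for v
      using schreier_finite[OF that] by auto
    \<comment> \<open>The union has the same minimum as its first block, and this minimum prescribes
      the number of blocks; equal minima thus give equally long lists.\<close>
    have hd: "hd vs \<subseteq> \<Union> (set vs) \<and> Min (hd vs) = Min (\<Union> (set vs))"
      if "vs \<noteq> []" "sorted_wrt blt vs" "\<forall>t\<in>set vs. schreier L (opow_omega \<beta>) t" for vs
    proof -
      obtain v vs' where vs: "vs = v # vs'" using \<open>vs \<noteq> []\<close> by (cases vs) auto
      have v: "finite v" "v \<noteq> {}" and fin': "finite (\<Union> (set vs))"
        using that fin by (auto simp: vs)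
      have "Min v \<le> y" if "y \<in> u" "u \<in> set vs'" for y u
      proof -
        have "blt v u" "finite u" using that \<open>sorted_wrt blt vs\<close> fin
          \<open>\<forall>t\<in>set vs. schreier L (opow_omega \<beta>) t\<close> by (auto simp: vs)
        then show ?thesis using v that Min_in[OF v] by (meson blt_iff less_imp_le)
      qed
      then have "Min (\<Union> (set vs)) = Min v"
        using v fin' Min_in[of v] by (intro Min_eqI) (auto simp: vs)
      then show ?thesis by (simp add: vs)
    qed
    have "schreier L (opow_omega (osuc \<beta>)) (\<Union> (set ss))"
      using pow_succ by (intro schreier.pow_succ) auto
    then have "Min (\<Union> (set ss)) = Min (\<Union> (set us))"
      using comp st schreier_finite opow_omega_neq_ozero unfolding us(1) by (metis comparable_MinD)
    then have len: "length ss = length us"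
      using pow_succ us hd[of ss] hd[of us] by simp
    have "ss = us"
    proof (rule comparable_Union_lists)
      show "list_all2 (\<lambda>t c. finite t \<and> schreier L c t \<and> (\<forall>t'. schreier L c t' \<longrightarrow> comparable t t' \<longrightarrow> t = t'))
          ss (replicate (length ss) (opow_omega \<beta>))"
        using pow_succ fin by (auto simp: list_all2_conv_all_nth)
      show "list_all2 (\<lambda>t c. finite t \<and> schreier L c t) us (replicate (length ss) (opow_omega \<beta>))"
        using us fin len by (auto simp: list_all2_conv_all_nth)
    qed (use pow_succ us comp in auto)
    then show "\<Union> (set ss) = t" using us by simp
  qed
next
  case (pow_limit l s)
  show ?case
  proof (intro allI impI)
    fix t assume st: "schreier L (opow_omega l) t" and comp: "comparable s t"
    \<comment> \<open>Equal minima select the same term of the sequence \<open>L l\<close>, so both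
      sets lie in one smaller family.\<close>
    then have "Min s = Min t"
      using pow_limit schreier_finite[OF st] by (intro comparable_MinD) auto
    then show "s = t" using pow_limit.IH schreier_pow_limitE[OF st pow_limit.hyps(1)] comp by simp
  qed
next
  case (sum \<xi> a m p T)
  define P where "P c t \<longleftrightarrow> schreier L (opow_omega c) t \<and>
    (\<forall>t'. schreier L (opow_omega c) t' \<longrightarrow> comparable t t' \<longrightarrow> t = t')" for c t
  have fin: "\<forall>c t. P c t \<longrightarrow> finite t \<and> t \<noteq> {}"
    unfolding P_def using schreier_finite by fastforce
  have T: "\<forall>i\<le>m. length (T i) = p i \<and> sorted_wrt blt (T i) \<and> (\<forall>t\<in>set (T i). P (a i) t)"
    using sum(11) unfolding P_def by blast
  obtain ts cs where ts: "(\<Union>i\<le>m. \<Union> (set (T i))) = \<Union> (set ts)" "\<xi> = cantor cs"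
    "sorted_wrt (\<ge>) cs" "sorted_wrt blt ts" "list_all2 (\<lambda>t c. P c t) ts (rev cs)"
    using sum_normal_form[where P = P and T = T, OF sum(5,6,9) T sum(10) fin] by auto
  show ?case
  proof (intro allI impI)
    fix t assume st: "schreier L \<xi> t" and comp: "comparable (\<Union>i\<le>m. \<Union> (set (T i))) t"
    have "\<xi> \<noteq> opow_omega b" for b
      using sum(3,4) by (auto simp: less_osuc_iff)
    with st sum(1) obtain us ds where us: "t = \<Union> (set us)" "\<xi> = cantor ds" "sorted_wrt (\<ge>) ds"
      "sorted_wrt blt us" "list_all2 (\<lambda>t c. schreier L (opow_omega c) t) us (rev ds)"
      by (rule schreier_sumE)
    \<comment> \<open>Both lists are normal forms of \<open>\<xi>\<close>, so \<open>ts\<close> and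
      \<open>us\<close> run through the same families.\<close>
    have "cs = ds" using ts us by (intro cantor_inject) auto
    have "ts = us"
    proof (rule comparable_Union_lists)
      show "list_all2 (\<lambda>t c. finite t \<and> schreier L (opow_omega c) t \<and>
          (\<forall>t'. schreier L (opow_omega c) t' \<longrightarrow> comparable t t' \<longrightarrow> t = t')) ts (rev cs)"
        using ts(5) by (rule list_all2_mono) (use schreier_finite in \<open>auto simp: P_def\<close>)
      show "list_all2 (\<lambda>t c. finite t \<and> schreier L (opow_omega c) t) us (rev cs)"
        unfolding \<open>cs = ds\<close> using us(5) by (rule list_all2_mono) (use schreier_finite in auto)
    qed (use ts us comp in auto)
    then show "(\<Union>i\<le>m. \<Union> (set (T i))) = t" unfolding us(1) ts(1) by simp
  qed
qed

section \<open>Thinness of the block families and the conclusion\<close>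

text \<open>Later blocks have larger minima, so the minima of \<open>ss\<close> form an initial
  segment of those of \<open>us\<close>, and thinness of the Schreier family makes them equal. A
  further block would add a new minimum.\<close>

lemma block_schreier_thin:
  assumes ss: "ss \<in> block_schreier L \<xi>" and us: "us \<in> block_schreier L \<xi>" and "prefix ss us"
  shows "ss = us"
proof (cases "\<xi> = ozero")
  case True
  then show ?thesis using ss us by (simp add: block_schreier_def)
next
  case False
  obtain vs where vs: "us = ss @ vs" using \<open>prefix ss us\<close> by (rule prefixE)
  have mins: "schreier L \<xi> (Min ` set ss)" "schreier L \<xi> (Min ` set us)"
    and coll: "us \<in> finite_collections"
    using ss us False by (auto simp: block_schreier_def schreier_family_def)
  have less: "Min s < Min v" if "s \<in> set ss" "v \<in> set vs" for s v
  proof -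
    have "blt s v" "block s" "block v"
      using that coll vs by (auto simp: finite_collections_def sorted_wrt_append)
    then show ?thesis by (simp add: blt_iff block_def)
  qed
  have "initial_segment (Min ` set ss) (Min ` set us)"
    unfolding initial_segment_def using less by (force simp: vs)
  with mins have eq: "Min ` set ss = Min ` set us"
    using schreier_thin by (auto simp: comparable_def)
  have "set vs = {}"
  proof (rule equals0I)
    fix v assume v: "v \<in> set vs"
    then have "Min v \<in> Min ` set ss" using eq vs by auto
    then obtain s where "s \<in> set ss" "Min s = Min v" by auto
    then show False using less[of s v] v by simp
  qed
  then show ?thesis using vs by simp
qed

theorem theorem1p8:
  fixes L :: "cord \<Rightarrow> nat \<Rightarrow> cord"
    and F :: "nat set list set"
    and D\<^sub>0 :: "nat \<Rightarrow> nat set"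
    and \<xi> :: cord
  assumes "fundamental_sequences L"
    and "F \<subseteq> finite_collections"
    and "infinite_collection D\<^sub>0"
  shows "\<exists>D. infinite_collection D \<and> refines D D\<^sub>0 \<and>
    (block_schreier L \<xi> \<inter> finite_collections_in D \<subseteq> F \<or>
     block_schreier L \<xi> \<inter> finite_collections_in D \<subseteq> finite_collections - F)"
proof -
  obtain D where "infinite_collection D" "refines D D\<^sub>0"
    "block_schreier L \<xi> \<inter> finite_collections_in D \<subseteq> F \<or>
      block_schreier L \<xi> \<inter> finite_collections_in D \<inter> F = {}"
    using nash_williams_block[OF assms(3) block_schreier_thin] .
  moreover have "finite_collections_in D \<subseteq> finite_collections"
    by (auto simp: finite_collections_in_def)
  ultimately show ?thesis by blast
qed

end
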